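(* For $n\ge1$ let $Q_n$ be a uniformly random Stirling permutation of length $2n$, and let $X_n$, $Y_n$, $Z_n$ denote respectively the numbers of ascents, descents and plateaux of $Q_n$. Then, as $n\to\infty$, \[ n^{-1/2}\bigl(X_n-2n/3,\;Y_n-2n/3,\;Z_n-2n/3\bigr)\ \xrightarrow{d}\ N(0,\Sigma), \] a centered trivariate normal distribution with covariance matrix \[ \Sigma=\frac1{18}\begin{pmatrix} 2 & -1 & -1\\ -1 & 2 & -1\\ -1 & -1 & 2\end{pmatrix}. \]
   Context: A Stirling permutation of length $2n$ is a permutation (word) $a_1a_2\cdots a_{2n}$ of the multiset $\{1,1,2,2,\dots,n,n\}$ such that for each $i\le n$, all elements occurring between the two occurrences of $i$ are larger than $i$. A uniformly random Stirling permutation is a uniformly random element of the finite set of all Stirling permutations of length $2n$. Set $a_0=a_{2n+1}=0$. An index $i\in\{0,1,\dots,2n\}$ is an ascent if $a_i<a_{i+1}$, a descent if $a_i>a_{i+1}$, and a plateau if $a_i=a_{i+1}$. $\xrightarrow{d}$ denotes convergence in distribution. *)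

theory Defs
  imports "HOL-Probability.Probability" "HOL-Library.Multiset"
begin

definition stirling_perms :: "nat \<Rightarrow> nat list set" where
  "stirling_perms n =
     {w. mset w = repeat_mset 2 (mset_set {1..n}) \<and>
         (\<forall>p q r. p < q \<and> q < r \<and> r < length w \<and> w ! p = w ! r \<longrightarrow> w ! p < w ! q)}"

text \<open>The word with the boundary letters $a_0 = a_{2n+1} = 0$ added.\<close>

definition padded :: "nat list \<Rightarrow> nat list" where
  "padded w = 0 # w @ [0]"

definition ascents :: "nat list \<Rightarrow> nat" where
  "ascents w = card {i \<in> {0..length w}. padded w ! i < padded w ! (i + 1)}"

definition descents :: "nat list \<Rightarrow> nat" where
  "descents w = card {i \<in> {0..length w}. padded w ! i > padded w ! (i + 1)}"

definition plateaux :: "nat list \<Rightarrow> nat" where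
  "plateaux w = card {i \<in> {0..length w}. padded w ! i = padded w ! (i + 1)}"

lemma finite_stirling_perms: "finite (stirling_perms n)"
proof -
  let ?M = "repeat_mset 2 (mset_set {1..n})"
  have "stirling_perms n \<subseteq> {w. set w \<subseteq> set_mset ?M \<and> length w = size ?M}"
  proof
    fix w assume "w \<in> stirling_perms n"
    then have "mset w = ?M" unfolding stirling_perms_def by blast
    then show "w \<in> {w. set w \<subseteq> set_mset ?M \<and> length w = size ?M}"
      by (metis (mono_tags, lifting) mem_Collect_eq order_refl set_mset_mset size_mset)
  qed
  then show ?thesis
    by (rule finite_subset) (rule finite_lists_length_eq, rule finite_set_mset)
qed

lemma stirling_perms_nonempty: "stirling_perms n \<noteq> {}"
proof -
  have "\<exists>w. w \<in> stirling_perms n"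
  proof (induction n)
    case 0
    show ?case by (auto simp: stirling_perms_def intro!: exI[of _ "[]"])
  next
    case (Suc n)
    then obtain w where w: "w \<in> stirling_perms n" by blast
    have m: "mset w = repeat_mset 2 (mset_set {1..n})"
      using w by (simp add: stirling_perms_def)
    have s: "set w \<subseteq> {1..n}"
    proof
      fix x assume "x \<in> set w"
      then have "x \<in># repeat_mset 2 (mset_set {1..n})" using m by (metis set_mset_mset)
      then show "x \<in> {1..n}" by (simp add: numeral_2_eq_2)
    qed
    let ?v = "Suc n # Suc n # w"
    have "mset ?v = repeat_mset 2 (mset_set {1..Suc n})"
      by (simp add: m atLeastAtMostSuc_conv numeral_2_eq_2)
    moreover have "?v ! p < ?v ! q"
      if h: "p < q" "q < r" "r < length ?v" "?v ! p = ?v ! r" for p q r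
    proof -
      obtain r' where r: "r = Suc (Suc r')"
        using h(1,2) by (cases r; cases "r - 1") auto
      have "w ! r' \<in> set w" using h r by auto
      then have "?v ! r \<le> n" using s r by (auto simp: subset_iff)
      then have "?v ! p \<noteq> Suc n" using h(4) by linarith
      then have "p \<noteq> 0" "p \<noteq> Suc 0" by (metis nth_Cons_0, metis nth_Cons_0 nth_Cons_Suc)
      then obtain p' where p: "p = Suc (Suc p')" by (metis not0_implies_Suc)
      obtain q' where q: "q = Suc (Suc q')" using h(1) p by (metis Suc_lessE)
      have "p' < q'" "q' < r'" "r' < length w" "w ! p' = w ! r'"
        using h by (simp_all add: p q r)
      then have "w ! p' < w ! q'"
        using w unfolding stirling_perms_def by blast
      then show ?thesis by (simp add: p q)
    qed
    ultimately show ?case unfolding stirling_perms_def by blast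
  qed
  then show ?thesis by blast
qed

definition random_stirling :: "nat \<Rightarrow> nat list pmf" where
  "random_stirling n = pmf_of_set (stirling_perms n)"

text \<open>The library's \<^const>\<open>weak_conv_m\<close> only covers measures on the real line.\<close>

definition weakly_converges ::
    "(nat \<Rightarrow> 'a::topological_space measure) \<Rightarrow> 'a measure \<Rightarrow> bool" where
  "weakly_converges M N \<longleftrightarrow>
     (\<forall>f :: 'a \<Rightarrow> real. continuous_on UNIV f \<and> bounded (range f) \<longrightarrow>
        (\<lambda>n. \<integral>x. f x \<partial>M n) \<longlonglongrightarrow> (\<integral>x. f x \<partial>N))"

definition normal_law :: "real measure \<Rightarrow> bool" where
  "normal_law M \<longleftrightarrow>
     (\<exists>m. M = return borel m) \<or>
     (\<exists>m \<sigma>. \<sigma> > 0 \<and> M = density lborel (normal_density m \<sigma>))"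

text \<open>
  A law on $R^d$ is (jointly) normal if every linear functional is normally distributed,
  point masses included, so that singular covariance matrices are allowed.
\<close>

definition multivariate_normal ::
    "real ^ 'd \<Rightarrow> real ^ 'd ^ 'd \<Rightarrow> (real ^ 'd) measure \<Rightarrow> bool" where
  "multivariate_normal \<mu> \<Sigma> N \<longleftrightarrow>
     prob_space N \<and> sets N = sets borel \<and>
     (\<forall>t. normal_law (distr N borel (\<lambda>x. t \<bullet> x))) \<and>
     (\<forall>i. (\<integral>x. x $ i \<partial>N) = \<mu> $ i) \<and>
     (\<forall>i j. (\<integral>x. (x $ i - \<mu> $ i) * (x $ j - \<mu> $ j) \<partial>N) = \<Sigma> $ i $ j)"

end

theory Submission
  imports Defs "HOL-Library.Sublist" "HOL-Real_Asymp.Real_Asymp"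
begin

text \<open>
  Inserting the pair $(n+1)(n+1)$ into one of the $2n+1$ gaps of a Stirling permutation replaces the
  type of that gap by one ascent, one plateau and one descent. Hence the three counts form an urn:
  draw a ball uniformly and add one ball of each of the two other colours. The composition centered
  at $(2n+1)/3$ is, after multiplication by deterministic weights, a martingale with bounded
  increments before weighting. Its conditional covariance differs from that of a uniform draw by at
  most a multiple of the deviation divided by $n$, which is $O(n^{-1/2})$ in mean by a second moment
  bound. Comparing characteristic functions one step at a time gives a total error $O(n^{-1/2})$ and
  the limit $\exp(-q/4)$, where $q$ is the variance of the linear functional under a uniform draw.

  Pointwise convergence of characteristic functions on $R^d$ together with tightness gives weak
  convergence: substituting $\sin(\pi x_i / 2L)$ into a Stone-Weierstrass polynomial yields a
  trigonometric polynomial that is uniformly close to a given bounded continuous function on the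
  ball of radius $L$ and is bounded everywhere.
\<close>

section \<open>Stirling permutations as an urn\<close>

text \<open>Keeping the relation as a parameter lets one recursion serve all three statistics, and
  the count of a concatenation splits at the seam.\<close>

fun adjacent_count :: "(nat \<Rightarrow> nat \<Rightarrow> bool) \<Rightarrow> nat list \<Rightarrow> nat" where
  "adjacent_count R (x # y # zs) = of_bool (R x y) + adjacent_count R (y # zs)"
| "adjacent_count R _ = 0"

lemma adjacent_count_append:
  assumes "xs \<noteq> []" "ys \<noteq> []"
  shows "adjacent_count R (xs @ ys) =
    adjacent_count R xs + of_bool (R (last xs) (hd ys)) + adjacent_count R ys"
  using assms
proof (induction R xs rule: adjacent_count.induct)
  case ("2_2" R v)
  then show ?case by (cases ys) auto
qed auto

lemma card_adjacent_eq:
  "xs \<noteq> [] \<Longrightarrow> card {i. i < length xs - 1 \<and> R (xs ! i) (xs ! (i + 1))} = adjacent_count R xs"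
proof (induction R xs rule: adjacent_count.induct)
  case (1 R x y zs)
  let ?S = "{i. i < length (y # zs) - 1 \<and> R ((y # zs) ! i) ((y # zs) ! (i + 1))}"
  have "{i. i < length (x # y # zs) - 1 \<and> R ((x # y # zs) ! i) ((x # y # zs) ! (i + 1))} =
     (if R x y then {0} else {}) \<union> Suc ` ?S" (is "?L = ?Rr")
  proof (rule set_eqI)
    fix i show "i \<in> ?L \<longleftrightarrow> i \<in> ?Rr" by (cases i) auto
  qed
  moreover have "card (Suc ` ?S) = card ?S"
    by (rule card_image) simp
  ultimately show ?case
    using 1 by (auto simp: card_insert_if)
qed auto

lemma
  shows ascents_eq: "ascents w = adjacent_count (<) (padded w)"
    and descents_eq: "descents w = adjacent_count (>) (padded w)"
    and plateaux_eq: "plateaux w = adjacent_count (=) (padded w)"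
  by (auto simp: ascents_def descents_def plateaux_def padded_def less_Suc_eq_le
      simp flip: card_adjacent_eq intro!: arg_cong[where f = card])

lemma ascents_descents_plateaux: "ascents w + descents w + plateaux w = Suc (length w)"
proof -
  have "xs \<noteq> [] \<Longrightarrow> Suc (adjacent_count (<) xs + adjacent_count (>) xs + adjacent_count (=) xs) = length xs" for xs
  proof (induction xs rule: induct_list012)
    case (3 x y zs)
    then show ?case by (cases x y rule: linorder_cases) auto
  qed auto
  from this[of "padded w"] show ?thesis
    by (simp add: ascents_eq descents_eq plateaux_eq padded_def)
qed

definition insert_pair :: "nat \<Rightarrow> nat list \<Rightarrow> nat \<Rightarrow> nat list" where
  "insert_pair m w i = take i w @ [m, m] @ drop i w"

lemma length_padded: "length (padded w) = length w + 2"
  by (simp add: padded_def)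

text \<open>Only the gap at \<open>i\<close> is affected: its pair disappears and the pairs (left,
  m), (m, m), (m, right) appear. The lost pair is added on the left-hand side to avoid truncated
  subtraction.\<close>

lemma adjacent_count_insert_pair:
  assumes "i \<le> length w"
  shows "adjacent_count R (padded (insert_pair m w i)) + of_bool (R (padded w ! i) (padded w ! (i + 1))) =
    adjacent_count R (padded w) + of_bool (R (padded w ! i) m) + of_bool (R m m) + of_bool (R m (padded w ! (i + 1)))"
proof -
  \<comment> \<open>The padding zeros make both halves nonempty even for the two outer gaps.\<close>
  define A B where "A = 0 # take i w" and "B = drop i w @ [0]"
  have ne: "A \<noteq> []" "B \<noteq> []" by (auto simp: A_def B_def)
  have w: "padded w = A @ B" by (simp add: padded_def A_def B_def)
  have len: "length A = i + 1" using assms by (simp add: A_def)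
  have "last A = padded w ! i" "hd B = padded w ! (i + 1)"
    using ne len by (auto simp: w nth_append last_conv_nth hd_conv_nth)
  moreover have "padded (insert_pair m w i) = A @ [m, m] @ B"
    by (simp add: padded_def A_def B_def insert_pair_def)
  ultimately show ?thesis
    using ne by (cases B) (simp_all add: w adjacent_count_append)
qed

text \<open>Since \<open>m\<close> exceeds both neighbours, padding zeros included, the new pairs
  are one ascent, one plateau and one descent. A count therefore rises by one unless the destroyed
  gap was of its own type.\<close>

lemma
  assumes "i \<le> length w" "set w \<subseteq> {..<m}" "0 < m"
  shows ascents_insert_pair:
      "ascents (insert_pair m w i) = ascents w + of_bool (\<not> padded w ! i < padded w ! (i + 1))"
    and descents_insert_pair:
      "descents (insert_pair m w i) = descents w + of_bool (\<not> padded w ! i > padded w ! (i + 1))"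
    and plateaux_insert_pair:
      "plateaux (insert_pair m w i) = plateaux w + of_bool (padded w ! i \<noteq> padded w ! (i + 1))"
proof -
  have "set (padded w) \<subseteq> {..<m}" using assms by (auto simp: padded_def)
  moreover have "padded w ! i \<in> set (padded w)" "padded w ! (i + 1) \<in> set (padded w)"
    using assms(1) by (auto intro!: nth_mem simp: length_padded)
  ultimately have lt: "padded w ! i < m" "padded w ! (i + 1) < m" by auto
  show "ascents (insert_pair m w i) = ascents w + of_bool (\<not> padded w ! i < padded w ! (i + 1))"
    "descents (insert_pair m w i) = descents w + of_bool (\<not> padded w ! i > padded w ! (i + 1))"
    "plateaux (insert_pair m w i) = plateaux w + of_bool (padded w ! i \<noteq> padded w ! (i + 1))"
    using adjacent_count_insert_pair[OF assms(1), of "(<)" m] adjacent_count_insert_pair[OF assms(1), of "(>)" m]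
      adjacent_count_insert_pair[OF assms(1), of "(=)" m] lt
    by (auto simp: ascents_eq descents_eq plateaux_eq of_bool_def split: if_splits)
qed

lemma set_stirling_perm: "w \<in> stirling_perms n \<Longrightarrow> set w \<subseteq> {1..n}"
proof -
  assume "w \<in> stirling_perms n"
  then have "set_mset (mset w) = set_mset (repeat_mset 2 (mset_set {1..n}))"
    by (simp add: stirling_perms_def)
  then show ?thesis by (auto simp: numeral_2_eq_2)
qed

lemma length_stirling_perm: "w \<in> stirling_perms n \<Longrightarrow> length w = 2 * n"
proof -
  assume "w \<in> stirling_perms n"
  then have "size (mset w) = size (repeat_mset 2 (mset_set {1..n}))"
    by (simp add: stirling_perms_def)
  then show ?thesis by (simp add: numeral_2_eq_2)
qed

section \<open>Nested words and the recursive structure of Stirling permutations\<close>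

text \<open>The index condition is rephrased through patterns a, y, a, so that inserting and
  deleting letters is handled by subsequences instead of index shifts.\<close>

definition nested :: "nat list \<Rightarrow> bool" where
  "nested w \<longleftrightarrow> (\<forall>a y. subseq [a, y, a] w \<longrightarrow> a < y)"

lemma nested_iff:
  "nested w \<longleftrightarrow> (\<forall>p q r. p < q \<and> q < r \<and> r < length w \<and> w ! p = w ! r \<longrightarrow> w ! p < w ! q)"
proof (intro iffI allI impI)
  fix p q r assume n: "nested w" and h: "p < q \<and> q < r \<and> r < length w \<and> w ! p = w ! r"
  \<comment> \<open>Cutting \<open>w\<close> at \<open>r\<close>, and then the prefix at
    \<open>p\<close>, isolates the letters between the two equal ones; \<open>w ! q\<close> is among
    them.\<close>
  define ys where "ys = drop (Suc p) (take r w)"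
  have "w = take r w @ w ! r # drop (Suc r) w"
    using h by (simp add: id_take_nth_drop)
  also have "take r w = take p (take r w) @ take r w ! p # ys"
    unfolding ys_def using h by (intro id_take_nth_drop) auto
  finally have w: "w = take p (take r w) @ w ! p # ys @ w ! p # drop (Suc r) w"
    using h by simp
  have "w ! q = ys ! (q - Suc p)" using h by (simp add: ys_def)
  moreover have "q - Suc p < length ys" using h by (auto simp: ys_def)
  ultimately have "subseq [w ! q] ys" by (simp add: subseq_singleton_left)
  then have "subseq ([w ! q] @ [w ! p]) (ys @ w ! p # drop (Suc r) w)"
    by (intro list_emb_append_mono) auto
  then have "subseq [w ! p, w ! q, w ! p] w"
    by (subst w) (rule list_emb_append2, simp)
  then show "w ! p < w ! q" using n by (simp add: nested_def)
next
  assume h: "\<forall>p q r. p < q \<and> q < r \<and> r < length w \<and> w ! p = w ! r \<longrightarrow> w ! p < w ! q"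
  show "nested w" unfolding nested_def
  proof (intro allI impI)
    fix a y assume "subseq [a, y, a] w"
    then obtain xs us where 1: "w = xs @ a # us" "subseq [y, a] us"
      by (blast dest: list_emb_ConsD)
    then obtain ys us' where 2: "us = ys @ y # us'" "subseq [a] us'"
      by (blast dest: list_emb_ConsD)
    then obtain zs vs where "us' = zs @ a # vs"
      by (blast dest: list_emb_ConsD)
    with 1 2 have w: "w = xs @ a # ys @ y # zs @ a # vs" by simp
    have "w ! length xs = a" "w ! (length xs + Suc (length ys)) = y"
      "w ! (length xs + Suc (length ys + Suc (length zs))) = a"
      by (auto simp: w nth_append)
    then show "a < y"
      using h[rule_format, of "length xs" "length xs + Suc (length ys)" "length xs + Suc (length ys + Suc (length zs))"]
      by (simp add: w)
  qed
qed

lemma stirling_perms_nested: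
  "stirling_perms n = {w. mset w = repeat_mset 2 (mset_set {1..n}) \<and> nested w}"
  by (simp add: stirling_perms_def nested_iff)

text \<open>Nestedness forbids patterns, hence passes to subsequences.\<close>

lemma nested_delete_pair:
  assumes "nested (u @ m # m # v)"
  shows "nested (u @ v)"
proof -
  have "subseq (u @ v) (u @ m # m # v)" by (intro list_emb_append_mono) auto
  then show ?thesis using assms unfolding nested_def by (meson subseq_order.order_trans)
qed

text \<open>A pattern a, y, a cannot have \<open>a = m\<close>, because the only two copies of
  \<open>m\<close> are adjacent. If \<open>y = m\<close>, maximality of \<open>m\<close> suffices;
  otherwise deleting all copies of \<open>m\<close> moves the pattern into
  \<open>u @ v\<close>.\<close>

lemma nested_insert_pair:
  assumes "nested (u @ v)" "set (u @ v) \<subseteq> {..<m}"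
  shows "nested (u @ m # m # v)"
  unfolding nested_def
proof (intro allI impI)
  fix a y assume s: "subseq [a, y, a] (u @ m # m # v)"
  have um: "m \<notin> set u" "m \<notin> set v" using assms(2) by auto
  have "set [a, y, a] \<subseteq> set (u @ m # m # v)"
    using list_emb_set[OF s] by blast
  then have le: "a \<le> m" "y \<le> m" using assms(2) by auto
  have "a \<noteq> m"
  proof
    assume "a = m"
    moreover have "subseq (m # xs) (u @ ys) \<longleftrightarrow> subseq (m # xs) ys" for xs ys
      using um(1) by (induction u) auto
    ultimately have "subseq [y, m] (m # v)" using s by simp
    then have "subseq [m] v" by (cases "y = m") (auto dest: subseq_Cons')
    then show False using um by (simp add: subseq_singleton_left)
  qed
  moreover have "a < y" if "y \<noteq> m"
  proof -
    have "filter (\<lambda>z. z \<noteq> m) (u @ m # m # v) = u @ v"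
      using um filter_True[of u "\<lambda>z. z \<noteq> m"] filter_True[of v "\<lambda>z. z \<noteq> m"] by fastforce
    then have "subseq [a, y, a] (u @ v)"
      using subseq_filter[OF s, of "\<lambda>z. z \<noteq> m"] \<open>a \<noteq> m\<close> that by simp
    then show ?thesis using assms(1) by (simp add: nested_def)
  qed
  ultimately show "a < y" using le by fastforce
qed

lemma insert_pair_in_stirling_perms:
  assumes "w \<in> stirling_perms n"
  shows "insert_pair (Suc n) w i \<in> stirling_perms (Suc n)"
proof -
  have "nested (take i w @ Suc n # Suc n # drop i w)"
    using assms set_stirling_perm[OF assms] by (intro nested_insert_pair) (auto simp: stirling_perms_nested)
  moreover have "mset w = mset (take i w) + mset (drop i w)"
    by (metis append_take_drop_id mset_append)
  then have "mset (insert_pair (Suc n) w i) = mset w + {#Suc n, Suc n#}"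
    by (simp add: insert_pair_def)
  ultimately show ?thesis using assms
    by (simp add: stirling_perms_nested insert_pair_def atLeastAtMostSuc_conv numeral_2_eq_2)
qed

text \<open>No letter exceeds \<open>Suc n\<close>, so nothing fits between its two copies. They are
  adjacent, and deleting them undoes an insertion.\<close>

lemma stirling_perm_Suc_cases:
  assumes "w \<in> stirling_perms (Suc n)"
  obtains v i where "v \<in> stirling_perms n" "i \<le> 2 * n" "w = insert_pair (Suc n) v i"
proof -
  let ?m = "Suc n"
  have ms: "mset w = add_mset ?m (add_mset ?m (repeat_mset 2 (mset_set {1..n})))"
    using assms by (simp add: stirling_perms_nested atLeastAtMostSuc_conv numeral_2_eq_2)
  have nw: "nested w" using assms by (simp add: stirling_perms_nested)
  have le: "set w \<subseteq> {1..?m}" by (rule set_stirling_perm[OF assms])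
  have "?m \<in># mset w" using ms by simp
  then obtain xs us where w: "w = xs @ ?m # us" by (metis in_multiset_in_set split_list)
  have us: "mset xs + mset us = add_mset ?m (repeat_mset 2 (mset_set {1..n}))"
    using ms by (simp add: w)
  have "\<exists>u v. w = u @ ?m # ?m # v"
  proof -
    \<comment> \<open>The copy found first may be either of the two, so the other one is sought on
      both sides.\<close>
    have "?m \<in># mset xs + mset us" unfolding us by simp
    then consider "?m \<in> set xs" | "?m \<in> set us" by auto
    then obtain u ys v where w': "w = u @ ?m # ys @ ?m # v"
    proof cases
      case 1
      then obtain u ys where "xs = u @ ?m # ys" by (metis split_list)
      then show ?thesis using that w by simp
    next
      case 2
      then obtain ys v where "us = ys @ ?m # v" by (metis split_list)
      then show ?thesis using that w by simp
    qed
    have "ys = []"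
    proof (rule ccontr)
      assume "ys \<noteq> []"
      then obtain y where y: "y \<in> set ys" by (cases ys) auto
      have "subseq ([y] @ [?m]) (ys @ ?m # v)"
        using y by (intro list_emb_append_mono) (auto simp: subseq_singleton_left)
      then have "subseq [?m, y, ?m] w"
        unfolding w' by (intro list_emb_append2[of _ "[Suc n, y, Suc n]"]) simp
      then have "?m < y" using nw by (simp add: nested_def)
      moreover have "y \<le> ?m" using y le w' by auto
      ultimately show False by simp
    qed
    then show ?thesis using w' by auto
  qed
  then obtain u v where w: "w = u @ ?m # ?m # v" by blast
  have "nested (u @ v)" using nw unfolding w by (rule nested_delete_pair)
  moreover have "mset (u @ v) = repeat_mset 2 (mset_set {1..n})"
    using ms by (simp add: w)
  ultimately have uv: "u @ v \<in> stirling_perms n" by (simp add: stirling_perms_nested)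
  then have "length u \<le> 2 * n" using length_stirling_perm[OF uv] by simp
  then show ?thesis using uv by (intro that[of "u @ v" "length u"]) (auto simp: w insert_pair_def)
qed

text \<open>Injectivity holds because the new letter does not occur in the old word: the gap is
  recovered from the prefix before its first occurrence. Surjectivity is
  \<open>stirling_perm_Suc_cases\<close>.\<close>

lemma bij_betw_insert_pair:
  "bij_betw (\<lambda>(w, i). insert_pair (Suc n) w i) (stirling_perms n \<times> {..2 * n}) (stirling_perms (Suc n))"
proof (rule bij_betwI')
  fix x y assume "x \<in> stirling_perms n \<times> {..2 * n}" "y \<in> stirling_perms n \<times> {..2 * n}"
  moreover obtain w i v j where xy: "x = (w, i)" "y = (v, j)" by (cases x, cases y)
  ultimately have w: "w \<in> stirling_perms n" "i \<le> length w" and v: "v \<in> stirling_perms n" "j \<le> length v"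
    by (auto simp: length_stirling_perm)
  have m: "Suc n \<notin> set w" "Suc n \<notin> set v"
    using set_stirling_perm[OF w(1)] set_stirling_perm[OF v(1)] by auto
  show "(case x of (w, i) \<Rightarrow> insert_pair (Suc n) w i) = (case y of (w, i) \<Rightarrow> insert_pair (Suc n) w i) \<longleftrightarrow> x = y"
  proof
    assume "(case x of (w, i) \<Rightarrow> insert_pair (Suc n) w i) = (case y of (w, i) \<Rightarrow> insert_pair (Suc n) w i)"
    then have "take i w @ Suc n # (Suc n # drop i w) = take j v @ Suc n # (Suc n # drop j v)"
      by (simp add: xy insert_pair_def)
    moreover have "Suc n \<notin> set (take i w)" "Suc n \<notin> set (take j v)"
      using m by (auto dest: in_set_takeD)
    moreover have "takeWhile (\<lambda>z. z \<noteq> Suc n) (xs @ Suc n # ys) = xs" if "Suc n \<notin> set xs" for xs ys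
      using that by (induction xs) auto
    ultimately have "take i w = take j v" "drop i w = drop j v"
      by (metis, metis list.inject same_append_eq)
    then have "w = v" by (metis append_take_drop_id)
    moreover have "length (take i w) = length (take j v)" using \<open>take i w = take j v\<close> by simp
    then have "i = j" using w v by simp
    ultimately show "x = y" by (simp add: xy)
  qed simp
next
  fix x assume "x \<in> stirling_perms n \<times> {..2 * n}"
  then show "(case x of (w, i) \<Rightarrow> insert_pair (Suc n) w i) \<in> stirling_perms (Suc n)"
    by (auto intro: insert_pair_in_stirling_perms)
next
  fix y assume "y \<in> stirling_perms (Suc n)"
  then show "\<exists>x\<in>stirling_perms n \<times> {..2 * n}. y = (case x of (w, i) \<Rightarrow> insert_pair (Suc n) w i)"
    by (elim stirling_perm_Suc_cases) auto
qed

section \<open>The urn recursion for expectations\<close>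

lemma expectation_random_stirling:
  fixes f :: "nat list \<Rightarrow> 'b::{banach, second_countable_topology}"
  shows "measure_pmf.expectation (random_stirling n) f =
    (1 / card (stirling_perms n)) *\<^sub>R (\<Sum>w\<in>stirling_perms n. f w)"
  unfolding random_stirling_def
  by (subst integral_measure_pmf[of "stirling_perms n"])
    (auto simp: finite_stirling_perms stirling_perms_nonempty scaleR_sum_right)

lemma set_random_stirling [simp]: "set_pmf (random_stirling n) = stirling_perms n"
  by (simp add: random_stirling_def finite_stirling_perms stirling_perms_nonempty)

lemma integrable_random_stirling [simp]:
  fixes f :: "nat list \<Rightarrow> 'b::{banach, second_countable_topology}"
  shows "integrable (measure_pmf (random_stirling n)) f"
  by (rule integrable_measure_pmf_finite) (simp add: finite_stirling_perms)

text \<open>A uniform word of the next size is a uniform pair of a word and one of its 2n+1 gaps,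
  and each statistic is the number of gaps of its type; hence the drawing probabilities. General
  values of \<open>G\<close> cover both real second moments and complex characteristic
  functions.\<close>

lemma expectation_random_stirling_Suc:
  fixes G :: "nat \<Rightarrow> nat \<Rightarrow> nat \<Rightarrow> 'b::{banach, second_countable_topology}"
  shows "measure_pmf.expectation (random_stirling (Suc n)) (\<lambda>w. G (ascents w) (descents w) (plateaux w)) =
    measure_pmf.expectation (random_stirling n) (\<lambda>w.
      (ascents w / (2 * n + 1)) *\<^sub>R G (ascents w) (Suc (descents w)) (Suc (plateaux w)) +
      (descents w / (2 * n + 1)) *\<^sub>R G (Suc (ascents w)) (descents w) (Suc (plateaux w)) +
      (plateaux w / (2 * n + 1)) *\<^sub>R G (Suc (ascents w)) (Suc (descents w)) (plateaux w))"
proof -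
  let ?g = "\<lambda>w. G (ascents w) (descents w) (plateaux w)"
  have step: "(\<Sum>i\<le>2 * n. ?g (insert_pair (Suc n) w i)) =
      real (ascents w) *\<^sub>R G (ascents w) (Suc (descents w)) (Suc (plateaux w)) +
      real (descents w) *\<^sub>R G (Suc (ascents w)) (descents w) (Suc (plateaux w)) +
      real (plateaux w) *\<^sub>R G (Suc (ascents w)) (Suc (descents w)) (plateaux w)"
    if w: "w \<in> stirling_perms n" for w
  proof -
    let ?P = "padded w"
    define A B C where "A = {i \<in> {0..length w}. ?P ! i < ?P ! (i + 1)}"
      and "B = {i \<in> {0..length w}. ?P ! i > ?P ! (i + 1)}" and "C = {i \<in> {0..length w}. ?P ! i = ?P ! (i + 1)}"
    have len: "length w = 2 * n" using w by (rule length_stirling_perm)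
    have lt: "set w \<subseteq> {..<Suc n}" using set_stirling_perm[OF w] by auto
    note ins = ascents_insert_pair[OF _ lt] descents_insert_pair[OF _ lt] plateaux_insert_pair[OF _ lt]
    have "{..2 * n} = (A \<union> B) \<union> C" by (auto simp: A_def B_def C_def len)
    then have "(\<Sum>i\<le>2 * n. ?g (insert_pair (Suc n) w i)) = (\<Sum>i\<in>(A \<union> B) \<union> C. ?g (insert_pair (Suc n) w i))"
      by simp
    also have "\<dots> = (\<Sum>i\<in>A \<union> B. ?g (insert_pair (Suc n) w i)) + (\<Sum>i\<in>C. ?g (insert_pair (Suc n) w i))"
      by (rule sum.union_disjoint) (auto simp: A_def B_def C_def)
    also have "(\<Sum>i\<in>A \<union> B. ?g (insert_pair (Suc n) w i)) =
        (\<Sum>i\<in>A. ?g (insert_pair (Suc n) w i)) + (\<Sum>i\<in>B. ?g (insert_pair (Suc n) w i))"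
      by (rule sum.union_disjoint) (auto simp: A_def B_def)
    also have "(\<Sum>i\<in>A. ?g (insert_pair (Suc n) w i)) =
        (\<Sum>i\<in>A. G (ascents w) (Suc (descents w)) (Suc (plateaux w)))"
      by (rule sum.cong) (auto simp: A_def ins)
    also have "(\<Sum>i\<in>B. ?g (insert_pair (Suc n) w i)) =
        (\<Sum>i\<in>B. G (Suc (ascents w)) (descents w) (Suc (plateaux w)))"
      by (rule sum.cong) (auto simp: B_def ins)
    also have "(\<Sum>i\<in>C. ?g (insert_pair (Suc n) w i)) =
        (\<Sum>i\<in>C. G (Suc (ascents w)) (Suc (descents w)) (plateaux w))"
      by (rule sum.cong) (auto simp: C_def ins)
    finally show ?thesis
      by (simp add: sum_constant_scaleR A_def B_def C_def ascents_def descents_def plateaux_def)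
  qed
  \<comment> \<open>The number of words grows by the factor \<open>2 * n + 1\<close>, which
    normalizes the inner sum over gaps.\<close>
  have "card (stirling_perms (Suc n)) = card (stirling_perms n) * (2 * n + 1)"
    using bij_betw_same_card[OF bij_betw_insert_pair, of n] by (simp add: card_cartesian_product)
  moreover have "(\<Sum>w\<in>stirling_perms (Suc n). ?g w) =
      (\<Sum>(w, i)\<in>stirling_perms n \<times> {..2 * n}. ?g (insert_pair (Suc n) w i))"
    by (subst sum.reindex_bij_betw[OF bij_betw_insert_pair, symmetric]) (simp add: case_prod_unfold)
  then have "(\<Sum>w\<in>stirling_perms (Suc n). ?g w) =
      (\<Sum>w\<in>stirling_perms n. \<Sum>i\<le>2 * n. ?g (insert_pair (Suc n) w i))"
    by (simp add: sum.cartesian_product)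
  ultimately show ?thesis
    unfolding expectation_random_stirling
    by (simp add: step scaleR_sum_right scaleR_add_right distrib_left mult.assoc add.commute cong: sum.cong)
qed

section \<open>Characteristic functions and weak convergence on $R^d$\<close>

text \<open>The complex span of the characters, as an inductive predicate so that anything stable
  under linear combinations follows by induction.\<close>

inductive trig_poly :: "(real ^ 'd::finite \<Rightarrow> complex) \<Rightarrow> bool" where
  cis: "trig_poly (\<lambda>x. cis (t \<bullet> x))"
| scale: "trig_poly g \<Longrightarrow> trig_poly (\<lambda>x. c * g x)"
| add: "trig_poly g \<Longrightarrow> trig_poly h \<Longrightarrow> trig_poly (\<lambda>x. g x + h x)"

lemma trig_poly_const: "trig_poly (\<lambda>x. c)"
  using trig_poly.scale[OF trig_poly.cis[of 0], of c] by simp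

text \<open>Characters multiply by adding their frequencies; a nested induction extends this
  bilinearly.\<close>

lemma trig_poly_mult:
  assumes "trig_poly g" "trig_poly h"
  shows "trig_poly (\<lambda>x. g x * h x)"
  using assms
proof (induction g rule: trig_poly.induct)
  case (cis t)
  from this show ?case
  proof (induction h rule: trig_poly.induct)
    case (cis s)
    then show ?case using trig_poly.cis[of "t + s"] by (simp add: cis_mult inner_add_left)
  next
    case (scale h c)
    then show ?case using trig_poly.scale[of "\<lambda>x. cis (t \<bullet> x) * h x" c] by (simp add: mult.left_commute)
  next
    case (add h1 h2)
    then show ?case by (simp add: distrib_left trig_poly.add)
  qed
next
  case (scale g c)
  then show ?case using trig_poly.scale[of "\<lambda>x. g x * h x" c] by (simp add: mult.assoc)
next
  case (add g1 g2)
  then show ?case by (simp add: distrib_right trig_poly.add)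
qed

lemma trig_poly_sum:
  "finite I \<Longrightarrow> (\<And>i. i \<in> I \<Longrightarrow> trig_poly (g i)) \<Longrightarrow> trig_poly (\<lambda>x. \<Sum>i\<in>I. g i x)"
  by (induction I rule: finite_induct) (auto intro: trig_poly_const trig_poly.add)

text \<open>Euler's formula, with frequencies \<open>c\<close> and \<open>- c\<close> along axis
  \<open>i\<close>.\<close>

lemma trig_poly_sin: "trig_poly (\<lambda>x. complex_of_real (sin (c * x $ i)))"
proof -
  have "trig_poly (\<lambda>x. (1 / (2 * \<i>)) * cis ((c *\<^sub>R axis i 1) \<bullet> x) + (- 1 / (2 * \<i>)) * cis ((- c *\<^sub>R axis i 1) \<bullet> x))"
    by (intro trig_poly.intros)
  also have "(\<lambda>x. (1 / (2 * \<i>)) * cis ((c *\<^sub>R axis i 1) \<bullet> x) + (- 1 / (2 * \<i>)) * cis ((- c *\<^sub>R axis i 1) \<bullet> x)) =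
     (\<lambda>x. complex_of_real (sin (c * x $ i)))"
    by (rule ext) (simp add: inner_axis' complex_eq_iff)
  finally show ?thesis .
qed

lemma trig_poly_polynomial_sin:
  fixes p :: "real ^ 'd \<Rightarrow> real"
  assumes "real_polynomial_function p"
  shows "trig_poly (\<lambda>x. complex_of_real (p (\<chi> i. sin (c * x $ i))))"
  using assms
proof (induction rule: real_polynomial_function.induct)
  case (linear f)
  \<comment> \<open>A linear functional is a combination of coordinates, which reduces this case to
    single sines.\<close>
  have f_eq: "f y = (\<Sum>i\<in>UNIV. y $ i * f (axis i 1))" for y
  proof -
    interpret f: bounded_linear f by fact
    have "f y = f (\<Sum>i\<in>UNIV. y $ i *\<^sub>R axis i 1)"
      by (rule arg_cong[where f = f]) (simp add: vec_eq_iff axis_def if_distrib cong: if_cong)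
    then show ?thesis by (simp add: f.sum f.scale)
  qed
  have "(\<lambda>x. complex_of_real (f (\<chi> i. sin (c * x $ i)))) =
      (\<lambda>x. \<Sum>i\<in>UNIV. complex_of_real (f (axis i 1)) * complex_of_real (sin (c * x $ i)))"
    by (rule ext, subst f_eq) (simp add: mult.commute)
  then show ?case by (simp add: trig_poly_sum trig_poly.scale trig_poly_sin)
qed (auto intro: trig_poly_const trig_poly_mult trig_poly.add)

lemma trig_poly_continuous: "trig_poly g \<Longrightarrow> continuous_on UNIV g"
  by (induction rule: trig_poly.induct) (auto intro!: continuous_intros simp: cis_conv_exp)

lemma trig_poly_bounded: "trig_poly g \<Longrightarrow> \<exists>B. \<forall>x. norm (g x) \<le> B"
proof (induction rule: trig_poly.induct)
  case (scale g c)
  then obtain B where "\<forall>x. norm (g x) \<le> B" by blast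
  then have "norm (c * g x) \<le> norm c * B" for x by (simp add: norm_mult mult_left_mono)
  then show ?case by blast
next
  case (add g h)
  then obtain B C where "\<forall>x. norm (g x) \<le> B" "\<forall>x. norm (h x) \<le> C" by blast
  then have "norm (g x + h x) \<le> B + C" for x by (intro norm_triangle_mono) auto
  then show ?case by blast
qed (auto intro: exI[of _ 1])

lemma trig_poly_integrable:
  fixes M :: "(real ^ 'd) measure"
  assumes "trig_poly g" "prob_space M" "sets M = sets borel"
  shows "integrable M g"
proof -
  interpret prob_space M by fact
  obtain B where "\<forall>x. norm (g x) \<le> B" using trig_poly_bounded[OF assms(1)] by blast
  moreover have "g \<in> borel_measurable M"
    using borel_measurable_continuous_onI[OF trig_poly_continuous[OF assms(1)]] measurable_cong_sets[OF assms(3) refl] by blast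
  ultimately show ?thesis by (intro integrable_const_bound[where B = B]) auto
qed

text \<open>The bound by $B + \epsilon$ holds on the whole space because the sine substitution takes
  values in the cube on which the polynomial approximates.\<close>

lemma trig_poly_approximation:
  fixes f :: "real ^ 'd \<Rightarrow> real"
  assumes f: "continuous_on UNIV f" and B: "\<And>x. \<bar>f x\<bar> \<le> B" and "\<epsilon> > 0" "L > 0"
  obtains g :: "real ^ 'd \<Rightarrow> real" where "trig_poly (\<lambda>x. complex_of_real (g x))"
    "\<And>x. \<bar>g x\<bar> \<le> B + \<epsilon>" "\<And>x. norm x \<le> L \<Longrightarrow> \<bar>g x - f x\<bar> \<le> \<epsilon>"
proof -
  \<comment> \<open>With this scaling, every coordinate of a point in the ball of radius
    \<open>L\<close> lands in [-pi/2, pi/2], where arcsin inverts sin.\<close>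
  define c where "c = pi / (2 * L)"
  have c: "c > 0" "c * L = pi / 2" using assms by (simp_all add: c_def)
  define K :: "(real ^ 'd) set" where "K = cbox (\<chi> i. -1) (\<chi> i. 1)"
  \<comment> \<open>\<open>F\<close> is \<open>f\<close> in the coordinates y_i = sin (c x_i). A
    polynomial close to \<open>F\<close> on the cube becomes, after substituting the sines, close to
    \<open>f\<close> on the ball.\<close>
  define F where "F y = f (\<chi> i. arcsin (y $ i) / c)" for y
  have K: "y \<in> K \<longleftrightarrow> (\<forall>i. -1 \<le> y $ i \<and> y $ i \<le> 1)" for y
    by (simp add: K_def mem_box_cart)
  have "continuous_on K (\<lambda>y. \<chi> i. arcsin (y $ i) / c)"
    using c K by (intro continuous_on_vec_lambda continuous_intros) auto
  then have "continuous_on K F"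
    unfolding F_def by (rule continuous_on_compose2[OF f]) auto
  then obtain p where p: "real_polynomial_function p" "\<And>y. y \<in> K \<Longrightarrow> \<bar>F y - p y\<bar> < \<epsilon>"
    using Stone_Weierstrass_real_polynomial_function[of K F \<epsilon>] \<open>\<epsilon> > 0\<close> by (auto simp: K_def)
  define \<Phi> :: "real ^ 'd \<Rightarrow> real ^ 'd" where "\<Phi> x = (\<chi> i. sin (c * x $ i))" for x
  have \<Phi>: "\<Phi> x \<in> K" for x by (simp add: K \<Phi>_def)
  have F_bound: "\<bar>F y\<bar> \<le> B" for y by (simp add: F_def B)
  have F_\<Phi>: "F (\<Phi> x) = f x" if "norm x \<le> L" for x
  proof -
    have "arcsin (sin (c * x $ i)) = c * x $ i" for i
    proof -
      have "\<bar>c * x $ i\<bar> \<le> c * L"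
        using component_le_norm_cart[of x i] that c by (simp add: abs_mult)
      then show ?thesis using c by (intro arcsin_sin) auto
    qed
    then show ?thesis using c by (simp add: F_def \<Phi>_def)
  qed
  show ?thesis
  proof
    show "trig_poly (\<lambda>x. complex_of_real (p (\<Phi> x)))"
      unfolding \<Phi>_def by (rule trig_poly_polynomial_sin[OF p(1)])
    show "\<bar>p (\<Phi> x)\<bar> \<le> B + \<epsilon>" for x
      using p(2)[OF \<Phi>[of x]] F_bound[of "\<Phi> x"] by linarith
    show "\<bar>p (\<Phi> x) - f x\<bar> \<le> \<epsilon>" if "norm x \<le> L" for x
      using p(2)[OF \<Phi>[of x]] F_\<Phi>[OF that] by linarith
  qed
qed

section \<open>From characteristic functions to weak convergence\<close>

text \<open>The difference is at most \<open>\<epsilon>\<close> on the ball, and at most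
  \<open>B + C\<close> outside it, on a set of mass at most \<open>\<delta>\<close>.\<close>

lemma integral_diff_le_on_ball:
  fixes M :: "(real ^ 'd) measure"
  assumes "prob_space M" "sets M = sets borel"
    and "continuous_on UNIV f" "continuous_on UNIV g"
    and f: "\<And>x. \<bar>f x\<bar> \<le> B" and g: "\<And>x. \<bar>g x\<bar> \<le> C"
    and fg: "\<And>x. norm x \<le> L \<Longrightarrow> \<bar>g x - f x\<bar> \<le> \<epsilon>" and "0 \<le> \<epsilon>"
    and tail: "measure M {x. norm x > L} \<le> \<delta>"
  shows "\<bar>(\<integral>x. g x \<partial>M) - (\<integral>x. f x \<partial>M)\<bar> \<le> \<epsilon> + (B + C) * \<delta>"
proof -
  interpret prob_space M by fact
  note [measurable_cong] = assms(2)
  have [measurable]: "f \<in> borel_measurable borel" "g \<in> borel_measurable borel"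
    using assms by (auto intro: borel_measurable_continuous_onI)
  have i: "integrable M f" "integrable M g"
    using f g by (auto intro: integrable_const_bound[where B = B] integrable_const_bound[where B = C])
  have ind: "integrable M (indicator {x. norm x > L} :: _ \<Rightarrow> real)"
    by (rule integrable_const_bound[where B = 1]) (auto simp: indicator_def)
  have BC: "0 \<le> B + C" using f[of 0] g[of 0] by linarith
  have "\<bar>(\<integral>x. g x \<partial>M) - (\<integral>x. f x \<partial>M)\<bar> = \<bar>\<integral>x. g x - f x \<partial>M\<bar>"
    using i by simp
  also have "\<dots> \<le> (\<integral>x. \<bar>g x - f x\<bar> \<partial>M)" by (rule integral_abs_bound)
  also have "\<dots> \<le> (\<integral>x. \<epsilon> + (B + C) * indicator {x. norm x > L} x \<partial>M)"
  proof (rule integral_mono)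
    fix x show "\<bar>g x - f x\<bar> \<le> \<epsilon> + (B + C) * indicator {x. norm x > L} x"
      using fg[of x] f[of x] g[of x] \<open>0 \<le> \<epsilon>\<close> by (cases "norm x \<le> L") auto
  qed (use i ind in auto)
  also have "\<dots> = \<epsilon> + (B + C) * measure M {x. norm x > L}"
    using ind prob_space by (simp add: sets_eq_imp_space_eq[OF assms(2)])
  also have "\<dots> \<le> \<epsilon> + (B + C) * \<delta>"
    using tail BC by (simp add: mult_left_mono)
  finally show ?thesis .
qed

text \<open>Integrals of trigonometric polynomials converge by linearity. A bounded continuous
  function is replaced by one such polynomial, with an error uniform over all the measures because
  tightness supplies a common radius.\<close>

theorem weakly_converges_if_characteristic_functions_converge:
  fixes M :: "nat \<Rightarrow> (real ^ 'd) measure" and N :: "(real ^ 'd) measure"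
  assumes M: "\<And>n. prob_space (M n)" "\<And>n. sets (M n) = sets borel"
    and N: "prob_space N" "sets N = sets borel"
    and char: "\<And>t. (\<lambda>n. \<integral>x. cis (t \<bullet> x) \<partial>M n) \<longlonglongrightarrow> (\<integral>x. cis (t \<bullet> x) \<partial>N)"
    and tight: "\<And>\<delta>. \<delta> > 0 \<Longrightarrow> \<exists>L>0. (\<forall>n. measure (M n) {x. norm x > L} \<le> \<delta>) \<and> measure N {x. norm x > L} \<le> \<delta>"
  shows "weakly_converges M N"
  unfolding weakly_converges_def
proof (intro allI impI)
  fix f :: "real ^ 'd \<Rightarrow> real" assume "continuous_on UNIV f \<and> bounded (range f)"
  then obtain B where f: "continuous_on UNIV f" and B: "\<And>x. \<bar>f x\<bar> \<le> B"
    by (auto simp: bounded_iff)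
  have "B \<ge> 0" using B[of 0] by linarith
  have trig: "(\<lambda>n. \<integral>x. g x \<partial>M n) \<longlonglongrightarrow> (\<integral>x. g x \<partial>N)" if "trig_poly g" for g
    using that
  proof (induction rule: trig_poly.induct)
    case (scale g c)
    then show ?case by (simp add: tendsto_mult_left)
  next
    case (add g h)
    have "(\<integral>x. g x + h x \<partial>P) = (\<integral>x. g x \<partial>P) + (\<integral>x. h x \<partial>P)"
      if "prob_space P" "sets P = sets borel" for P
      using that add.hyps by (intro Bochner_Integration.integral_add trig_poly_integrable)
    then show ?case using tendsto_add[OF add.IH] M N by simp
  qed (rule char)
  show "(\<lambda>n. \<integral>x. f x \<partial>M n) \<longlonglongrightarrow> (\<integral>x. f x \<partial>N)"
  proof (rule LIMSEQ_I)
    fix r :: real assume "r > 0"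
    \<comment> \<open>\<open>\<epsilon> \<le> 1\<close> bounds the approximant by B + 1, so the
      outside of the ball costs at most r/8 and the ball at most r/4. Two such errors of 3r/8 leave
      r/4 for the convergence of the approximant.\<close>
    define \<epsilon> where "\<epsilon> = min 1 (r / 4)"
    define \<delta> where "\<delta> = r / (8 * (2 * B + 1))"
    have "\<epsilon> > 0" "\<epsilon> \<le> 1" "\<epsilon> \<le> r / 4" "\<delta> > 0" using \<open>r > 0\<close> \<open>B \<ge> 0\<close> by (auto simp: \<epsilon>_def \<delta>_def)
    obtain L where L: "L > 0" "\<And>n. measure (M n) {x. norm x > L} \<le> \<delta>" "measure N {x. norm x > L} \<le> \<delta>"
      using tight[OF \<open>\<delta> > 0\<close>] by blast
    obtain g where g: "trig_poly (\<lambda>x. complex_of_real (g x))"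
      "\<And>x. \<bar>g x\<bar> \<le> B + \<epsilon>" "\<And>x. norm x \<le> L \<Longrightarrow> \<bar>g x - f x\<bar> \<le> \<epsilon>"
      using trig_poly_approximation[OF f B \<open>\<epsilon> > 0\<close> \<open>L > 0\<close>] by blast
    have cont: "continuous_on UNIV g"
      using continuous_on_Re[OF trig_poly_continuous[OF g(1)]] by simp
    have "(B + (B + \<epsilon>)) * \<delta> \<le> (2 * B + 1) * \<delta>"
      using \<open>\<epsilon> \<le> 1\<close> \<open>\<delta> > 0\<close> by (intro mult_right_mono) auto
    also have "\<dots> = r / 8" using \<open>B \<ge> 0\<close> by (simp add: \<delta>_def field_simps)
    finally have err: "\<epsilon> + (B + (B + \<epsilon>)) * \<delta> \<le> 3 * r / 8" using \<open>\<epsilon> \<le> r / 4\<close> by simp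
    have close: "\<bar>(\<integral>x. g x \<partial>P) - (\<integral>x. f x \<partial>P)\<bar> \<le> 3 * r / 8"
      if "prob_space P" "sets P = sets borel" "measure P {x. norm x > L} \<le> \<delta>" for P
      using integral_diff_le_on_ball[OF that(1,2) f cont B g(2,3) _ that(3)] \<open>\<epsilon> > 0\<close> err by linarith
    have "(\<lambda>n. \<integral>x. g x \<partial>M n) \<longlonglongrightarrow> (\<integral>x. g x \<partial>N)"
      using tendsto_Re[OF trig[OF g(1)]] by simp
    then obtain n0 where n0: "\<And>n. n \<ge> n0 \<Longrightarrow> \<bar>(\<integral>x. g x \<partial>M n) - (\<integral>x. g x \<partial>N)\<bar> < r / 4"
      using LIMSEQ_D[of _ _ "r / 4"] \<open>r > 0\<close> by fastforce
    show "\<exists>n0. \<forall>n\<ge>n0. norm ((\<integral>x. f x \<partial>M n) - (\<integral>x. f x \<partial>N)) < r"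
    proof (intro exI allI impI)
      fix n assume "n \<ge> n0"
      then show "norm ((\<integral>x. f x \<partial>M n) - (\<integral>x. f x \<partial>N)) < r"
        using n0[of n] close[OF M L(2), of n] close[OF N L(3)] \<open>r > 0\<close>
        unfolding real_norm_def by linarith
    qed
  qed
qed

section \<open>Gaussian laws with two independent factors\<close>

lemma char_eq_cis: "char M t = (\<integral>x. cis (t * x) \<partial>M)"
  by (simp add: char_def cis_conv_exp)

lemma borel_measurable_cis [measurable]: "cis \<in> borel_measurable borel"
  by (intro borel_measurable_continuous_onI continuous_intros)

text \<open>A normal law with covariance e e^T + f f^T. Two factors suffice for the limit, whose
  covariance has rank two because the three counts have a deterministic sum; it has no density on
  three-dimensional space.\<close>

definition two_factor_gaussian :: "real ^ 'd \<Rightarrow> real ^ 'd \<Rightarrow> (real ^ 'd) measure" where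
  "two_factor_gaussian e f =
     distr (std_normal_distribution \<Otimes>\<^sub>M std_normal_distribution) borel (\<lambda>(u, v). u *\<^sub>R e + v *\<^sub>R f)"

lemma sets_two_factor_gaussian: "sets (two_factor_gaussian e f) = sets borel"
  by (simp add: two_factor_gaussian_def)

interpretation std_normal: real_distribution std_normal_distribution
  by (rule real_dist_normal_dist)

interpretation std_normal_pair: pair_prob_space std_normal_distribution std_normal_distribution ..

lemma measurable_two_factor [measurable]:
  fixes e f :: "real ^ 'd"
  shows "(\<lambda>(u, v). u *\<^sub>R e + v *\<^sub>R f) \<in>
    borel_measurable (std_normal_distribution \<Otimes>\<^sub>M std_normal_distribution)"
  by measurable

lemma prob_space_two_factor_gaussian: "prob_space (two_factor_gaussian e f)"
  unfolding two_factor_gaussian_def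
  by (rule std_normal_pair.prob_space_distr) (rule measurable_two_factor)

text \<open>Fubini's theorem splits the integral into two one-dimensional characteristic
  functions.\<close>

lemma characteristic_function_two_factor_gaussian:
  "(\<integral>x. cis (t \<bullet> x) \<partial>two_factor_gaussian e f) = complex_of_real (exp (- ((t \<bullet> e)\<^sup>2 + (t \<bullet> f)\<^sup>2) / 2))"
proof -
  let ?S = std_normal_distribution
  define \<alpha> \<beta> where "\<alpha> = t \<bullet> e" and "\<beta> = t \<bullet> f"
  have "(\<integral>x. cis (t \<bullet> x) \<partial>two_factor_gaussian e f) =
      (\<integral>z. cis (t \<bullet> (case z of (u, v) \<Rightarrow> u *\<^sub>R e + v *\<^sub>R f)) \<partial>(?S \<Otimes>\<^sub>M ?S))"
    unfolding two_factor_gaussian_def by (rule integral_distr) measurable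
  also have "\<dots> = (\<integral>z. cis (\<alpha> * fst z) * cis (\<beta> * snd z) \<partial>(?S \<Otimes>\<^sub>M ?S))"
    by (intro Bochner_Integration.integral_cong)
      (auto simp: \<alpha>_def \<beta>_def cis_mult inner_add_right mult.commute split: prod.splits)
  also have "\<dots> = (\<integral>u. (\<integral>v. cis (\<alpha> * u) * cis (\<beta> * v) \<partial>?S) \<partial>?S)"
  proof -
    have "integrable (?S \<Otimes>\<^sub>M ?S) (\<lambda>z. cis (\<alpha> * fst z) * cis (\<beta> * snd z))"
      by (rule std_normal_pair.integrable_const_bound[where B = 1]) (auto simp: norm_mult)
    from std_normal_pair.integral_fst'[OF this] show ?thesis by simp
  qed
  also have "\<dots> = char ?S \<alpha> * char ?S \<beta>"
    by (simp add: char_eq_cis)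
  also have "\<dots> = complex_of_real (exp (- (\<alpha>\<^sup>2 + \<beta>\<^sup>2) / 2))"
    by (simp add: char_std_normal_distribution exp_add[symmetric] add_divide_distrib
        flip: of_real_mult of_real_exp)
  finally show ?thesis by (simp add: \<alpha>_def \<beta>_def)
qed

text \<open>Along multiples of \<open>t\<close> the characteristic function is that of a scaled
  standard normal variable, and Levy's uniqueness theorem identifies the law. Normality and moments
  of linear functionals thus become one-dimensional facts.\<close>

lemma distr_inner_two_factor_gaussian:
  "distr (two_factor_gaussian e f) borel (\<lambda>x. t \<bullet> x) =
   distr std_normal_distribution borel (\<lambda>x. sqrt ((t \<bullet> e)\<^sup>2 + (t \<bullet> f)\<^sup>2) * x)" (is "?P = ?Q")
proof (rule Levy_uniqueness)
  interpret G: prob_space "two_factor_gaussian e f" by (rule prob_space_two_factor_gaussian)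
  note [measurable_cong] = sets_two_factor_gaussian[of e f]
  show "real_distribution ?P" "real_distribution ?Q"
    by (auto intro!: G.prob_space_distr std_normal.prob_space_distr
        simp: real_distribution_def real_distribution_axioms_def)
  show "char ?P = char ?Q"
  proof
    fix s
    let ?r = "sqrt ((t \<bullet> e)\<^sup>2 + (t \<bullet> f)\<^sup>2)"
    have "char ?P s = (\<integral>x. cis ((s *\<^sub>R t) \<bullet> x) \<partial>two_factor_gaussian e f)"
      unfolding char_eq_cis by (subst integral_distr) simp_all
    also have "\<dots> = complex_of_real (exp (- ((s * ?r)\<^sup>2) / 2))"
      unfolding characteristic_function_two_factor_gaussian by (simp add: power_mult_distrib distrib_left)
    also have "\<dots> = char std_normal_distribution (s * ?r)"
      by (simp add: char_std_normal_distribution)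
    also have "\<dots> = char ?Q s"
      unfolding char_eq_cis by (subst integral_distr) (simp_all add: mult.assoc)
    finally show "char ?P s = char ?Q s" .
  qed
qed

lemma normal_law_scaled_std_normal: "normal_law (distr std_normal_distribution borel (\<lambda>x. r * x))"
proof (cases "r = 0")
  \<comment> \<open>The degenerate functional has the point mass that \<open>normal_law\<close>
    admits separately.\<close>
  case True
  have "distr std_normal_distribution borel (\<lambda>x. 0 :: real) = return borel 0"
    by (rule std_normal.distr_const) simp
  then show ?thesis using True by (auto simp: normal_law_def)
next
  case False
  have "distributed std_normal_distribution lborel (\<lambda>x. x) std_normal_density"
    by (auto simp: distributed_def intro!: distr_id2)
  then have "distributed std_normal_distribution lborel (\<lambda>x. 0 + r * x) (normal_density (0 + r * 0) (\<bar>r\<bar> * 1))"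
    using False by (intro std_normal.normal_density_affine) auto
  then have "distr std_normal_distribution lborel (\<lambda>x. r * x) = density lborel (normal_density 0 \<bar>r\<bar>)"
    by (simp add: distributed_def)
  moreover have "distr std_normal_distribution lborel (\<lambda>x. r * x) = distr std_normal_distribution borel (\<lambda>x. r * x)"
    by (rule distr_cong) auto
  ultimately show ?thesis using False unfolding normal_law_def by (metis zero_less_abs_iff)
qed

text \<open>All three are transported through the one-dimensional law of the functional to moments
  of the standard normal distribution.\<close>

lemma
  shows integral_inner_two_factor_gaussian: "(\<integral>x. t \<bullet> x \<partial>two_factor_gaussian e f) = 0"
    and integrable_inner_sq_two_factor_gaussian: "integrable (two_factor_gaussian e f) (\<lambda>x. (t \<bullet> x)\<^sup>2)"
    and integral_inner_sq_two_factor_gaussian: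
      "(\<integral>x. (t \<bullet> x)\<^sup>2 \<partial>two_factor_gaussian e f) = (t \<bullet> e)\<^sup>2 + (t \<bullet> f)\<^sup>2"
proof -
  note [measurable_cong] = sets_two_factor_gaussian[of e f]
  let ?N = "two_factor_gaussian e f" and ?S = std_normal_distribution
  let ?r = "sqrt ((t \<bullet> e)\<^sup>2 + (t \<bullet> f)\<^sup>2)"
  note law = distr_inner_two_factor_gaussian[of e f t]
  have "(\<integral>x. t \<bullet> x \<partial>?N) = (\<integral>y. y \<partial>distr ?N borel (\<lambda>x. t \<bullet> x))"
    by (rule integral_distr[symmetric]) measurable
  also have "\<dots> = (\<integral>x. ?r * x \<partial>?S)"
    unfolding law by (rule integral_distr) measurable
  also have "\<dots> = 0"
    using integral_std_normal_distribution_moment_odd[of 1] by simp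
  finally show "(\<integral>x. t \<bullet> x \<partial>?N) = 0" .
  have "integrable ?S (\<lambda>x. (?r * x)\<^sup>2)"
    using std_normal_distribution_even_moments(2)[of 1] by (simp add: power_mult_distrib)
  then have "integrable (distr ?S borel (\<lambda>x. ?r * x)) (\<lambda>y. y\<^sup>2)"
    by (subst integrable_distr_eq) simp_all
  then show "integrable ?N (\<lambda>x. (t \<bullet> x)\<^sup>2)"
    unfolding law[symmetric] by (subst (asm) integrable_distr_eq) simp_all
  have "(\<integral>x. (t \<bullet> x)\<^sup>2 \<partial>?N) = (\<integral>y. y\<^sup>2 \<partial>distr ?N borel (\<lambda>x. t \<bullet> x))"
    by (rule integral_distr[symmetric]) measurable
  also have "\<dots> = (\<integral>x. (?r * x)\<^sup>2 \<partial>?S)"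
    unfolding law by (rule integral_distr) measurable
  also have "\<dots> = ?r\<^sup>2"
    using std_normal_distribution_even_moments(1)[of 1] by (simp add: power_mult_distrib fact_numeral)
  finally show "(\<integral>x. (t \<bullet> x)\<^sup>2 \<partial>?N) = (t \<bullet> e)\<^sup>2 + (t \<bullet> f)\<^sup>2" by simp
qed

lemma multivariate_normal_two_factor_gaussian:
  "multivariate_normal 0 (\<chi> i j. e $ i * e $ j + f $ i * f $ j) (two_factor_gaussian e f)"
  unfolding multivariate_normal_def
proof (intro conjI allI)
  let ?N = "two_factor_gaussian e f"
  show "prob_space ?N" "sets ?N = sets borel"
    by (rule prob_space_two_factor_gaussian, rule sets_two_factor_gaussian)
  show "normal_law (distr ?N borel ((\<bullet>) t))" for t
    unfolding distr_inner_two_factor_gaussian by (rule normal_law_scaled_std_normal)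
  show "(\<integral>x. x $ i \<partial>?N) = 0 $ i" for i
    using integral_inner_two_factor_gaussian[of e f "axis i 1"] by (simp add: inner_axis')
  show "(\<integral>x. (x $ i - 0 $ i) * (x $ j - 0 $ j) \<partial>?N) = (\<chi> i j. e $ i * e $ j + f $ i * f $ j) $ i $ j" for i j
  proof -
    \<comment> \<open>Polarization: only squares of linear functionals have been integrated so
      far.\<close>
    have "x $ i * x $ j = (((axis i 1 + axis j 1) \<bullet> x)\<^sup>2 - (axis i 1 \<bullet> x)\<^sup>2 - (axis j 1 \<bullet> x)\<^sup>2) / 2"
      for x :: "real ^ 'a"
      by (simp add: inner_axis' inner_add_left power2_eq_square field_simps)
    then have "(\<integral>x. x $ i * x $ j \<partial>?N) =
        (\<integral>x. (((axis i 1 + axis j 1) \<bullet> x)\<^sup>2 - (axis i 1 \<bullet> x)\<^sup>2 - (axis j 1 \<bullet> x)\<^sup>2) / 2 \<partial>?N)"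
      by presburger
    also have "\<dots> = ((\<integral>x. ((axis i 1 + axis j 1) \<bullet> x)\<^sup>2 \<partial>?N) - (\<integral>x. (axis i 1 \<bullet> x)\<^sup>2 \<partial>?N) -
        (\<integral>x. (axis j 1 \<bullet> x)\<^sup>2 \<partial>?N)) / 2"
      by (simp add: integrable_inner_sq_two_factor_gaussian)
    also have "\<dots> = e $ i * e $ j + f $ i * f $ j"
      unfolding integral_inner_sq_two_factor_gaussian
      by (simp add: inner_axis' inner_add_left power2_eq_square field_simps)
    finally show ?thesis by simp
  qed
qed

text \<open>Markov's inequality for the squared norm; it provides tightness.\<close>

lemma measure_norm_gt_le_second_moment:
  fixes M :: "(real ^ 'd) measure"
  assumes "prob_space M" "sets M = sets borel" "integrable M (\<lambda>x. (norm x)\<^sup>2)"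
    and "(\<integral>x. (norm x)\<^sup>2 \<partial>M) \<le> C" "L > 0"
  shows "measure M {x. norm x > L} \<le> C / L\<^sup>2"
proof -
  interpret prob_space M by fact
  note [measurable_cong] = assms(2)
  have sp: "space M = UNIV" using sets_eq_imp_space_eq[OF assms(2)] by simp
  have "measure M {x. norm x > L} \<le> measure M {x \<in> space M. (norm x)\<^sup>2 \<ge> L\<^sup>2}"
    using \<open>L > 0\<close> by (intro finite_measure_mono) (auto simp: sp intro!: power_mono)
  also have "\<dots> \<le> (\<integral>x. (norm x)\<^sup>2 \<partial>M) / L\<^sup>2"
    using assms by (intro integral_Markov_inequality_measure[where A = "{}"]) auto
  also have "\<dots> \<le> C / L\<^sup>2" using assms by (intro divide_right_mono) auto
  finally show ?thesis .
qed

section \<open>The central limit theorem for the urn\<close>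

text \<open>From \<open>1 + z \<le> exp z\<close> comes exp (-z) \<le> 1/(1+z), which exceeds 1 - z
  by z^2/(1+z); and \<open>exp (- z)\<close> is at least \<open>1 - z\<close>.\<close>

lemma exp_minus_diff_le:
  fixes z :: real
  assumes "z \<ge> 0"
  shows "\<bar>exp (- z) - (1 - z)\<bar> \<le> z\<^sup>2"
proof -
  have "(1 + z) * exp (- z) \<le> 1"
    using exp_ge_add_one_self[of z] mult_right_mono[of "1 + z" "exp z" "exp (- z)"]
    by (simp add: exp_minus)
  then have "exp (- z) * (1 + z) - (1 - z) * (1 + z) \<le> z\<^sup>2"
    by (simp add: algebra_simps power2_eq_square)
  then have "(exp (- z) - (1 - z)) * (1 + z) \<le> z\<^sup>2"
    by (simp add: algebra_simps)
  moreover have "exp (- z) - (1 - z) \<ge> 0"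
    using exp_ge_add_one_self[of "- z"] by simp
  moreover from this have "(exp (- z) - (1 - z)) * 1 \<le> (exp (- z) - (1 - z)) * (1 + z)"
    using assms by (intro mult_left_mono) auto
  ultimately show ?thesis by simp
qed

lemma cis_quadratic_approx: "norm (cis y - (1 + \<i> * y - y\<^sup>2 / 2)) \<le> \<bar>y\<bar> ^ 3 / 6"
  using iexp_approx1[of y 2]
  by (simp add: cis_conv_exp numeral_eq_Suc power2_eq_square algebra_simps)

text \<open>Taylor expansion about the mean \<open>m\<close>: the linear term cancels, the quadratic
  term is the variance, and the cubic remainder uses |d j - m| \<le> 2D. The reference variance
  \<open>q\<close> may differ from the true one, which is the last term of the bound.\<close>

lemma centered_characteristic_function_approx:
  fixes p d :: "'i \<Rightarrow> real"
  assumes p: "\<And>j. j \<in> J \<Longrightarrow> 0 \<le> p j" "sum p J = 1"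
    and D: "\<And>j. j \<in> J \<Longrightarrow> \<bar>d j\<bar> \<le> D" and q: "0 \<le> q" "q \<le> D\<^sup>2" and a: "0 \<le> a"
    and m: "m = (\<Sum>j\<in>J. p j * d j)"
  shows "norm ((\<Sum>j\<in>J. p j * cis (a * (d j - m))) - complex_of_real (exp (- (a\<^sup>2 * q / 2)))) \<le>
    4 / 3 * D ^ 3 * a ^ 3 + D ^ 4 / 4 * a ^ 4 + a\<^sup>2 / 2 * \<bar>(\<Sum>j\<in>J. p j * (d j)\<^sup>2) - m\<^sup>2 - q\<bar>"
proof -
  let ?y = "\<lambda>j. a * (d j - m)"
  define s where "s = (\<Sum>j\<in>J. p j * (d j)\<^sup>2) - m\<^sup>2"
  have "\<bar>m\<bar> \<le> (\<Sum>j\<in>J. p j * D)"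
    unfolding m by (rule order_trans[OF sum_abs]) (auto intro!: sum_mono mult_left_mono simp: abs_mult p D)
  then have mD: "\<bar>m\<bar> \<le> D" by (simp add: p flip: sum_distrib_right)
  then have "0 \<le> D" by linarith
  have y1: "(\<Sum>j\<in>J. p j * ?y j) = 0"
  proof -
    have "(\<Sum>j\<in>J. p j * ?y j) = a * ((\<Sum>j\<in>J. p j * d j) - m * sum p J)"
      by (simp add: algebra_simps sum_subtractf sum_distrib_left)
    then show ?thesis by (simp add: p m)
  qed
  have "(\<Sum>j\<in>J. p j * (?y j)\<^sup>2) = (\<Sum>j\<in>J. a\<^sup>2 * (p j * (d j)\<^sup>2 - 2 * m * (p j * d j) + m\<^sup>2 * p j))"
    by (rule sum.cong) (auto simp: power2_eq_square algebra_simps)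
  also have "\<dots> = a\<^sup>2 * ((\<Sum>j\<in>J. p j * (d j)\<^sup>2) - 2 * m * m + m\<^sup>2 * 1)"
    unfolding sum_distrib_left[symmetric] sum.distrib sum_subtractf p(2) m[symmetric] ..
  finally have y2: "(\<Sum>j\<in>J. p j * (?y j)\<^sup>2) = a\<^sup>2 * s"
    by (simp add: s_def power2_eq_square)
  have "(\<Sum>j\<in>J. complex_of_real (p j) * (1 + \<i> * ?y j - (?y j)\<^sup>2 / 2)) =
      complex_of_real (sum p J) + \<i> * complex_of_real (\<Sum>j\<in>J. p j * ?y j) - complex_of_real (\<Sum>j\<in>J. p j * (?y j)\<^sup>2) / 2"
    by (simp add: sum.distrib sum_subtractf sum_distrib_left sum_divide_distrib distrib_left right_diff_distrib mult_ac)
  also have "\<dots> = complex_of_real (1 - a\<^sup>2 * s / 2)"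
    by (simp only: p y1 y2) simp
  finally have main: "(\<Sum>j\<in>J. complex_of_real (p j) * (1 + \<i> * ?y j - (?y j)\<^sup>2 / 2)) = complex_of_real (1 - a\<^sup>2 * s / 2)" .
  have "norm ((\<Sum>j\<in>J. p j * cis (?y j)) - complex_of_real (1 - a\<^sup>2 * s / 2)) =
      norm (\<Sum>j\<in>J. p j * (cis (?y j) - (1 + \<i> * ?y j - (?y j)\<^sup>2 / 2)))"
    unfolding main[symmetric] by (simp add: sum_subtractf right_diff_distrib)
  also have "\<dots> \<le> (\<Sum>j\<in>J. p j * (4 / 3 * D ^ 3 * a ^ 3))"
  proof (rule order_trans[OF norm_sum], rule sum_mono)
    fix j assume j: "j \<in> J"
    have "\<bar>?y j\<bar> \<le> a * (2 * D)"
      using D[OF j] mD a by (simp add: abs_mult) (intro mult_left_mono, auto)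
    then have "\<bar>?y j\<bar> ^ 3 \<le> (a * (2 * D)) ^ 3" by (intro power_mono) auto
    then have "norm (cis (?y j) - (1 + \<i> * ?y j - (?y j)\<^sup>2 / 2)) \<le> (a * (2 * D)) ^ 3 / 6"
      using cis_quadratic_approx[of "?y j"] by linarith
    also have "\<dots> = 4 / 3 * D ^ 3 * a ^ 3" by (simp add: power_mult_distrib)
    finally show "norm (p j * (cis (?y j) - (1 + \<i> * ?y j - (?y j)\<^sup>2 / 2))) \<le> p j * (4 / 3 * D ^ 3 * a ^ 3)"
      unfolding norm_mult norm_of_real using p(1)[OF j] by (intro mult_mono) auto
  qed
  also have "\<dots> = 4 / 3 * D ^ 3 * a ^ 3" by (simp only: p mult_1 flip: sum_distrib_right)
  finally have 1: "norm ((\<Sum>j\<in>J. p j * cis (?y j)) - complex_of_real (1 - a\<^sup>2 * s / 2)) \<le> 4 / 3 * D ^ 3 * a ^ 3" .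
  have "norm (complex_of_real (1 - a\<^sup>2 * s / 2) - complex_of_real (exp (- (a\<^sup>2 * q / 2)))) = \<bar>(1 - a\<^sup>2 * s / 2) - exp (- (a\<^sup>2 * q / 2))\<bar>"
    by (simp only: norm_of_real flip: of_real_diff)
  \<comment> \<open>Passing through \<open>1 - a\<^sup>2 * q / 2\<close> separates the linearization
    of the exponential from the variance mismatch.\<close>
  also have "\<dots> \<le> \<bar>exp (- (a\<^sup>2 * q / 2)) - (1 - a\<^sup>2 * q / 2)\<bar> + \<bar>a\<^sup>2 / 2 * (s - q)\<bar>"
  proof -
    have "a\<^sup>2 * s / 2 = a\<^sup>2 * q / 2 + a\<^sup>2 / 2 * (s - q)" by (simp add: field_simps)
    then show ?thesis by linarith
  qed
  also have "\<dots> \<le> (a\<^sup>2 * q / 2)\<^sup>2 + a\<^sup>2 / 2 * \<bar>s - q\<bar>"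
    using q by (intro add_mono exp_minus_diff_le) (auto simp: abs_mult)
  also have "(a\<^sup>2 * q / 2)\<^sup>2 = q\<^sup>2 / 4 * a ^ 4"
    by (simp add: power2_eq_square power4_eq_xxxx)
  also have "q\<^sup>2 \<le> (D\<^sup>2)\<^sup>2" using q by (intro power_mono) auto
  then have "q\<^sup>2 / 4 * a ^ 4 \<le> D ^ 4 / 4 * a ^ 4" by (simp add: mult_right_mono)
  finally have 2: "norm (complex_of_real (1 - a\<^sup>2 * s / 2) - complex_of_real (exp (- (a\<^sup>2 * q / 2)))) \<le> D ^ 4 / 4 * a ^ 4 + a\<^sup>2 / 2 * \<bar>s - q\<bar>"
    by simp
  show ?thesis using norm_diff_triangle_le[OF 1 2] by (simp add: s_def add.assoc)
qed

section \<open>Second moments of the urn\<close>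

lemma urn_square_step:
  fixes X M :: real
  assumes "0 \<le> X" "X \<le> M" "M > 0"
  shows "X / M * (X - (M + 2) / 3)\<^sup>2 + (M - X) / M * (X + 1 - (M + 2) / 3)\<^sup>2 \<le> (X - M / 3)\<^sup>2 + 1"
proof -
  define x p where "x = X - M / 3" and "p = X / M"
  have p: "0 \<le> p" "p \<le> 1" "(M - X) / M = 1 - p" using assms by (auto simp: p_def field_simps)
  have xp: "x * (1 / 3 - p) = - (x\<^sup>2 / M)" using assms by (simp add: x_def p_def power2_eq_square field_simps)
  have "p * (x - 2 / 3)\<^sup>2 + (1 - p) * (x + 1 / 3)\<^sup>2 = x\<^sup>2 + 2 * (x * (1 / 3 - p)) + p / 3 + 1 / 9"
    by (simp add: power2_eq_square field_simps)
  also have "\<dots> \<le> x\<^sup>2 + 1"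
  proof -
    have "x\<^sup>2 / M \<ge> 0" using assms by simp
    then show ?thesis using p xp by linarith
  qed
  finally show ?thesis by (simp add: x_def p(3) flip: p_def) (simp add: algebra_simps add_divide_distrib)
qed

lemma stirling_perms_0: "stirling_perms 0 = {[]}"
  by (auto simp: stirling_perms_def)

text \<open>By \<open>urn_square_step\<close> each insertion adds at most one; the empty word starts
  with at most 4/9.\<close>

lemma
  shows second_moment_ascents: "measure_pmf.expectation (random_stirling n) (\<lambda>w. (ascents w - (2 * real n + 1) / 3)\<^sup>2) \<le> n + 1" (is "?a n")
    and second_moment_descents: "measure_pmf.expectation (random_stirling n) (\<lambda>w. (descents w - (2 * real n + 1) / 3)\<^sup>2) \<le> n + 1" (is "?d n")
    and second_moment_plateaux: "measure_pmf.expectation (random_stirling n) (\<lambda>w. (plateaux w - (2 * real n + 1) / 3)\<^sup>2) \<le> n + 1" (is "?p n")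
proof -
  have "?a n \<and> ?d n \<and> ?p n"
  proof (induction n)
    case 0
    show ?case
      by (simp add: expectation_random_stirling stirling_perms_0 ascents_eq descents_eq plateaux_eq padded_def power2_eq_square)
  next
    case (Suc n)
    let ?E = "\<lambda>n. measure_pmf.expectation (random_stirling n)"
    let ?M = "2 * real n + 1"
    \<comment> \<open>One argument for all colours: \<open>S\<close> counts the chosen colour and
      \<open>T\<close> the other two together.\<close>
    have le: "?E n (\<lambda>w. g w) \<le> real (Suc n) + 1"
      if IH: "?E n (\<lambda>w. (S w - ?M / 3)\<^sup>2) \<le> n + 1"
        and g: "\<And>w. g w = S w / ?M * (S w - (?M + 2) / 3)\<^sup>2 + T w / ?M * (S w + 1 - (?M + 2) / 3)\<^sup>2"
        and T: "\<And>w. w \<in> stirling_perms n \<Longrightarrow> 0 \<le> S w \<and> 0 \<le> T w \<and> S w + T w = ?M"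
      for S T g :: "nat list \<Rightarrow> real"
    proof -
      have T': "S w \<le> ?M" "T w = ?M - S w" if "w \<in> stirling_perms n" for w
        using T[OF that] by linarith+
      have "?E n g \<le> ?E n (\<lambda>w. (S w - ?M / 3)\<^sup>2 + 1)"
        using T T' urn_square_step[of _ ?M] by (intro integral_mono_AE) (auto simp: AE_measure_pmf_iff g)
      also have "\<dots> = ?E n (\<lambda>w. (S w - ?M / 3)\<^sup>2) + 1" by simp
      finally show ?thesis using IH by simp
    qed
    have tot: "real (ascents w) + descents w + plateaux w = ?M" if "w \<in> stirling_perms n" for w
      using ascents_descents_plateaux[of w] length_stirling_perm[OF that] by linarith
    note E = expectation_random_stirling_Suc[of n, where 'b = real]
    have "?a (Suc n)"
      by (subst E[of "\<lambda>x y z. (real x - (2 * real (Suc n) + 1) / 3)\<^sup>2"],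
          rule le[of "\<lambda>w. real (ascents w)" _ "\<lambda>w. real (descents w) + real (plateaux w)"])
        (use Suc tot in \<open>auto simp: add_divide_distrib distrib_right add_ac\<close>)
    moreover have "?d (Suc n)"
      by (subst E[of "\<lambda>x y z. (real y - (2 * real (Suc n) + 1) / 3)\<^sup>2"],
          rule le[of "\<lambda>w. real (descents w)" _ "\<lambda>w. real (ascents w) + real (plateaux w)"])
        (use Suc tot in \<open>auto simp: add_divide_distrib distrib_right add_ac\<close>)
    moreover have "?p (Suc n)"
      by (subst E[of "\<lambda>x y z. (real z - (2 * real (Suc n) + 1) / 3)\<^sup>2"],
          rule le[of "\<lambda>w. real (plateaux w)" _ "\<lambda>w. real (ascents w) + real (descents w)"])
        (use Suc tot in \<open>auto simp: add_divide_distrib distrib_right add_ac\<close>)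
    ultimately show ?case by blast
  qed
  then show "?a n" "?d n" "?p n" by blast+
qed

text \<open>The pointwise bound 2 |X| r \<le> X^2 + r^2, integrated, plays the part of the
  Cauchy-Schwarz inequality.\<close>

lemma (in prob_space) expectation_abs_le_of_second_moment:
  fixes X :: "'a \<Rightarrow> real"
  assumes "integrable M X" "integrable M (\<lambda>x. (X x)\<^sup>2)" "expectation (\<lambda>x. (X x)\<^sup>2) \<le> r\<^sup>2" "r > 0"
  shows "expectation (\<lambda>x. \<bar>X x\<bar>) \<le> r"
proof -
  have "expectation (\<lambda>x. \<bar>X x\<bar>) \<le> expectation (\<lambda>x. (X x)\<^sup>2 / (2 * r) + r / 2)"
  proof (rule integral_mono)
    fix x
    have "2 * \<bar>X x\<bar> * r \<le> (X x)\<^sup>2 + r\<^sup>2"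
      using sum_squares_bound[of "\<bar>X x\<bar>" r] by simp
    then show "\<bar>X x\<bar> \<le> (X x)\<^sup>2 / (2 * r) + r / 2"
      using \<open>r > 0\<close> by (simp add: field_simps power2_eq_square)
  qed (use assms in auto)
  also have "\<dots> = expectation (\<lambda>x. (X x)\<^sup>2) / (2 * r) + r / 2"
    using assms by (simp add: prob_space)
  also have "\<dots> \<le> r\<^sup>2 / (2 * r) + r / 2"
    using assms by (intro add_right_mono divide_right_mono) auto
  also have "\<dots> = r" using \<open>r > 0\<close> by (simp add: power2_eq_square)
  finally show ?thesis .
qed

section \<open>Recursion for the characteristic functions of the urn\<close>

text \<open>The centre is a third of the number 2n+1 of gaps, so the three deviations sum to zero
  and the conditional mean after a step is an exact multiple of the current deviation.\<close>

definition urn_deviation :: "real ^ 3 \<Rightarrow> nat \<Rightarrow> nat list \<Rightarrow> real" where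
  "urn_deviation t n w =
     t $ 1 * (ascents w - (2 * real n + 1) / 3) +
     t $ 2 * (descents w - (2 * real n + 1) / 3) +
     t $ 3 * (plateaux w - (2 * real n + 1) / 3)"

text \<open>Given deviations \<open>x\<close>, colour j is drawn with probability 1/3 + x_j/M. The
  other two colours gain a ball and each centre rises by 2/3, so \<open>t \<bullet> x\<close>
  changes by \<tau> - t_j. The mean change - (t \<bullet> x)/M shrinks the phase by (M-1)/M, and the
  conditional variance differs from its uniform-draw value \<open>q\<close> by order |x|/M.\<close>

lemma urn_conditional_characteristic_function:
  fixes t :: "real ^ 3" and x :: "real ^ 3"
  defines "\<tau> \<equiv> (t $ 1 + t $ 2 + t $ 3) / 3"
  defines "q \<equiv> ((\<tau> - t $ 1)\<^sup>2 + (\<tau> - t $ 2)\<^sup>2 + (\<tau> - t $ 3)\<^sup>2) / 3"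
  assumes x0: "x $ 1 + x $ 2 + x $ 3 = 0" and M: "M > 0" and p: "\<And>j. 0 \<le> 1 / 3 + x $ j / M"
    and D: "\<And>j. \<bar>\<tau> - t $ j\<bar> \<le> D" and a: "0 \<le> a"
  shows "norm ((\<Sum>j\<in>UNIV. (1 / 3 + x $ j / M) *\<^sub>R cis (a * (t \<bullet> x + (\<tau> - t $ j)))) -
      complex_of_real (exp (- (a\<^sup>2 * q / 2))) * cis (a * ((M - 1) / M) * (t \<bullet> x))) \<le>
    4 / 3 * D ^ 3 * a ^ 3 + D ^ 4 / 4 * a ^ 4 + a\<^sup>2 * D\<^sup>2 * (\<bar>x $ 1\<bar> + \<bar>x $ 2\<bar> + \<bar>x $ 3\<bar>) / M"
proof -
  define p' d where "p' j = 1 / 3 + x $ j / M" and "d j = \<tau> - t $ j" for j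
  define m where "m = (\<Sum>j\<in>UNIV. p' j * d j)"
  define R where "R = \<bar>x $ 1\<bar> + \<bar>x $ 2\<bar> + \<bar>x $ 3\<bar>"
  have tx: "t \<bullet> x = t $ 1 * x $ 1 + t $ 2 * x $ 2 + t $ 3 * x $ 3"
    by (simp add: inner_vec_def sum_3)
  have x3: "x $ 3 = - x $ 1 - x $ 2" using x0 by simp
  have "0 \<le> D" using D[of 1] by linarith
  have p1: "sum p' UNIV = 1"
    using x0 M by (simp add: p'_def sum_3 flip: add_divide_distrib)
  have d0: "d 1 + d 2 + d 3 = 0" by (simp add: d_def \<tau>_def field_simps)
  have q: "q = ((d 1)\<^sup>2 + (d 2)\<^sup>2 + (d 3)\<^sup>2) / 3" by (simp add: q_def d_def)
  have D': "\<bar>d j\<bar> \<le> D" for j using D by (simp add: d_def)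
  have dD: "(d j)\<^sup>2 \<le> D\<^sup>2" for j using power_mono[OF D', of j 2] by simp
  have q_bounds: "0 \<le> q" "q \<le> D\<^sup>2" using dD[of 1] dD[of 2] dD[of 3] unfolding q by auto
  \<comment> \<open>The constant \<open>\<tau>\<close> in \<open>d\<close> drops out because the
    deviations sum to zero.\<close>
  have L: "t \<bullet> x = - (x $ 1 * d 1 + x $ 2 * d 2 + x $ 3 * d 3)"
    by (simp add: tx d_def x3 algebra_simps)
  have "m = (d 1 + d 2 + d 3) / 3 + (x $ 1 * d 1 + x $ 2 * d 2 + x $ 3 * d 3) / M"
    by (simp add: m_def p'_def sum_3 add_divide_distrib distrib_right)
  then have m: "m = - (t \<bullet> x) / M" using L d0 by simp
  have "\<bar>m\<bar> \<le> (\<Sum>j\<in>UNIV. p' j * D)"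
    unfolding m_def by (rule order_trans[OF sum_abs]) (use p D' in \<open>auto intro!: sum_mono mult_left_mono simp: abs_mult p'_def\<close>)
  then have mD: "\<bar>m\<bar> \<le> D" by (simp add: p1 flip: sum_distrib_right)
  have xd: "\<bar>x $ j * d j\<bar> \<le> \<bar>x $ j\<bar> * D" for j using D'[of j] by (simp add: abs_mult mult_left_mono)
  have xdd: "\<bar>x $ j * (d j)\<^sup>2\<bar> \<le> \<bar>x $ j\<bar> * D\<^sup>2" for j using dD[of j] by (simp add: abs_mult mult_left_mono)
  have LR: "\<bar>t \<bullet> x\<bar> \<le> R * D"
    using xd[of 1] xd[of 2] xd[of 3] unfolding L R_def by (simp only: distrib_right) linarith
  have "(\<Sum>j\<in>UNIV. p' j * (d j)\<^sup>2) - q = (x $ 1 * (d 1)\<^sup>2 + x $ 2 * (d 2)\<^sup>2 + x $ 3 * (d 3)\<^sup>2) / M"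
    by (simp add: p'_def q sum_3 add_divide_distrib distrib_right)
  moreover have "\<bar>x $ 1 * (d 1)\<^sup>2 + x $ 2 * (d 2)\<^sup>2 + x $ 3 * (d 3)\<^sup>2\<bar> \<le> R * D\<^sup>2"
    using xdd[of 1] xdd[of 2] xdd[of 3] unfolding R_def by (simp only: distrib_right) linarith
  ultimately have 1: "\<bar>(\<Sum>j\<in>UNIV. p' j * (d j)\<^sup>2) - q\<bar> \<le> R * D\<^sup>2 / M"
    using M by (simp add: divide_right_mono)
  \<comment> \<open>Only one factor is bounded through \<open>R\<close>, the other by
    \<open>D\<close>: the result stays linear in \<open>R\<close>, whose expectation will be
    controlled.\<close>
  have "m\<^sup>2 = \<bar>m\<bar> * (\<bar>t \<bullet> x\<bar> / M)"
    using M by (simp add: m power2_eq_square)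
  also have "\<dots> \<le> D * (R * D / M)"
    using mD LR M \<open>0 \<le> D\<close> by (intro mult_mono divide_right_mono) auto
  finally have 2: "m\<^sup>2 \<le> R * D\<^sup>2 / M" by (simp add: power2_eq_square mult_ac)
  have "\<bar>(\<Sum>j\<in>UNIV. p' j * (d j)\<^sup>2) - m\<^sup>2 - q\<bar> \<le> \<bar>(\<Sum>j\<in>UNIV. p' j * (d j)\<^sup>2) - q\<bar> + m\<^sup>2"
    using zero_le_power2[of m] by linarith
  then have 3: "\<bar>(\<Sum>j\<in>UNIV. p' j * (d j)\<^sup>2) - m\<^sup>2 - q\<bar> \<le> 2 * (R * D\<^sup>2 / M)"
    using 1 2 by linarith
  \<comment> \<open>Splits off the conditional mean, whose phase is a common factor of modulus one;
    the remainder is centered.\<close>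
  have ph: "a * (t \<bullet> x + d j) = a * ((M - 1) / M) * (t \<bullet> x) + a * (d j - m)" for j
    using M by (simp add: m field_simps)
  have "(\<Sum>j\<in>UNIV. p' j *\<^sub>R cis (a * (t \<bullet> x + d j))) =
      cis (a * ((M - 1) / M) * (t \<bullet> x)) * (\<Sum>j\<in>UNIV. p' j * cis (a * (d j - m)))"
    unfolding ph sum_distrib_left by (intro sum.cong) (auto simp: scaleR_conv_of_real mult_ac simp flip: cis_mult)
  then have "(\<Sum>j\<in>UNIV. p' j *\<^sub>R cis (a * (t \<bullet> x + d j))) - complex_of_real (exp (- (a\<^sup>2 * q / 2))) * cis (a * ((M - 1) / M) * (t \<bullet> x)) =
      cis (a * ((M - 1) / M) * (t \<bullet> x)) * ((\<Sum>j\<in>UNIV. p' j * cis (a * (d j - m))) - complex_of_real (exp (- (a\<^sup>2 * q / 2))))"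
    by (simp add: algebra_simps)
  then have "norm ((\<Sum>j\<in>UNIV. p' j *\<^sub>R cis (a * (t \<bullet> x + d j))) - complex_of_real (exp (- (a\<^sup>2 * q / 2))) * cis (a * ((M - 1) / M) * (t \<bullet> x))) =
      norm ((\<Sum>j\<in>UNIV. p' j * cis (a * (d j - m))) - complex_of_real (exp (- (a\<^sup>2 * q / 2))))"
    by (simp only: norm_mult norm_cis mult_1)
  also have "\<dots> \<le> 4 / 3 * D ^ 3 * a ^ 3 + D ^ 4 / 4 * a ^ 4 + a\<^sup>2 / 2 * \<bar>(\<Sum>j\<in>UNIV. p' j * (d j)\<^sup>2) - m\<^sup>2 - q\<bar>"
    by (rule centered_characteristic_function_approx) (use p p1 D' q_bounds a m_def in \<open>auto simp: p'_def\<close>)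
  also have "\<dots> \<le> 4 / 3 * D ^ 3 * a ^ 3 + D ^ 4 / 4 * a ^ 4 + a\<^sup>2 / 2 * (2 * (R * D\<^sup>2 / M))"
    using 3 by (intro add_left_mono mult_left_mono) auto
  also have "\<dots> = 4 / 3 * D ^ 3 * a ^ 3 + D ^ 4 / 4 * a ^ 4 + a\<^sup>2 * D\<^sup>2 * R / M" by simp
  finally show ?thesis unfolding p'_def d_def R_def .
qed

text \<open>The conditional estimate is averaged over the words. By the second moments each absolute
  deviation has mean at most sqrt (n+1), which divided by 2n+1 \<ge> n+1 gives the last
  term.\<close>

lemma urn_characteristic_function_step:
  fixes t :: "real ^ 3"
  defines "\<tau> \<equiv> (t $ 1 + t $ 2 + t $ 3) / 3"
  defines "q \<equiv> ((\<tau> - t $ 1)\<^sup>2 + (\<tau> - t $ 2)\<^sup>2 + (\<tau> - t $ 3)\<^sup>2) / 3"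
  assumes D: "\<And>j. \<bar>\<tau> - t $ j\<bar> \<le> D" and a: "0 \<le> a"
  shows "norm (measure_pmf.expectation (random_stirling (Suc n)) (\<lambda>w. cis (a * urn_deviation t (Suc n) w)) -
      complex_of_real (exp (- (a\<^sup>2 * q / 2))) *
      measure_pmf.expectation (random_stirling n) (\<lambda>w. cis (a * (2 * n / (2 * n + 1)) * urn_deviation t n w))) \<le>
    4 / 3 * D ^ 3 * a ^ 3 + D ^ 4 / 4 * a ^ 4 + 3 * D\<^sup>2 * a\<^sup>2 / sqrt (n + 1)"
proof -
  let ?E = "\<lambda>n. measure_pmf.expectation (random_stirling n)"
  define M where "M = 2 * real n + 1"
  define x :: "nat list \<Rightarrow> real ^ 3" where
    "x w = vector [ascents w - M / 3, descents w - M / 3, plateaux w - M / 3]" for w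
  define R where "R w = \<bar>x w $ 1\<bar> + \<bar>x w $ 2\<bar> + \<bar>x w $ 3\<bar>" for w
  have "M > 0" by (simp add: M_def)
  have dev: "urn_deviation t n w = t \<bullet> x w" for w
    by (simp add: urn_deviation_def x_def M_def inner_vec_def sum_3 vector_3)
  have pj: "1 / 3 + x w $ 1 / M = ascents w / M" "1 / 3 + x w $ 2 / M = descents w / M"
    "1 / 3 + x w $ 3 / M = plateaux w / M" for w
    using \<open>M > 0\<close> by (simp_all add: x_def vector_3 field_simps)
  have "?E (Suc n) (\<lambda>w. cis (a * urn_deviation t (Suc n) w)) =
      ?E n (\<lambda>w. \<Sum>j\<in>UNIV. (1 / 3 + x w $ j / M) *\<^sub>R cis (a * (t \<bullet> x w + (\<tau> - t $ j))))"
    unfolding urn_deviation_def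
    by (subst expectation_random_stirling_Suc[of n "\<lambda>X Y Z. cis (a * (
       t $ 1 * (X - (2 * real (Suc n) + 1) / 3) + t $ 2 * (Y - (2 * real (Suc n) + 1) / 3) +
       t $ 3 * (Z - (2 * real (Suc n) + 1) / 3)))"])
      (simp add: sum_3 pj, simp add: M_def x_def \<tau>_def inner_vec_def sum_3 vector_3 algebra_simps add_divide_distrib)
  then have "norm (?E (Suc n) (\<lambda>w. cis (a * urn_deviation t (Suc n) w)) -
        complex_of_real (exp (- (a\<^sup>2 * q / 2))) * ?E n (\<lambda>w. cis (a * (2 * n / (2 * n + 1)) * urn_deviation t n w))) =
      norm (?E n (\<lambda>w. (\<Sum>j\<in>UNIV. (1 / 3 + x w $ j / M) *\<^sub>R cis (a * (t \<bullet> x w + (\<tau> - t $ j)))) -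
        complex_of_real (exp (- (a\<^sup>2 * q / 2))) * cis (a * ((M - 1) / M) * (t \<bullet> x w))))"
    by (simp add: dev M_def add.commute)
  also have "\<dots> \<le> ?E n (\<lambda>w. norm ((\<Sum>j\<in>UNIV. (1 / 3 + x w $ j / M) *\<^sub>R cis (a * (t \<bullet> x w + (\<tau> - t $ j)))) -
        complex_of_real (exp (- (a\<^sup>2 * q / 2))) * cis (a * ((M - 1) / M) * (t \<bullet> x w))))"
    by (rule integral_norm_bound)
  also have "\<dots> \<le> ?E n (\<lambda>w. 4 / 3 * D ^ 3 * a ^ 3 + D ^ 4 / 4 * a ^ 4 + a\<^sup>2 * D\<^sup>2 * R w / M)"
  proof (rule integral_mono_AE)
    show "AE w in measure_pmf (random_stirling n).
      norm ((\<Sum>j\<in>UNIV. (1 / 3 + x w $ j / M) *\<^sub>R cis (a * (t \<bullet> x w + (\<tau> - t $ j)))) -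
        complex_of_real (exp (- (a\<^sup>2 * q / 2))) * cis (a * ((M - 1) / M) * (t \<bullet> x w))) \<le>
      4 / 3 * D ^ 3 * a ^ 3 + D ^ 4 / 4 * a ^ 4 + a\<^sup>2 * D\<^sup>2 * R w / M"
      unfolding AE_measure_pmf_iff set_random_stirling
    proof
      fix w assume w: "w \<in> stirling_perms n"
      have "real (ascents w) + descents w + plateaux w = M"
        using ascents_descents_plateaux[of w] length_stirling_perm[OF w] by (simp add: M_def)
      then have x0: "x w $ 1 + x w $ 2 + x w $ 3 = 0" by (simp add: x_def vector_3)
      have "\<forall>j. 0 \<le> 1 / 3 + x w $ j / M"
        unfolding forall_3 pj using \<open>M > 0\<close> by simp
      then show "norm ((\<Sum>j\<in>UNIV. (1 / 3 + x w $ j / M) *\<^sub>R cis (a * (t \<bullet> x w + (\<tau> - t $ j)))) -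
        complex_of_real (exp (- (a\<^sup>2 * q / 2))) * cis (a * ((M - 1) / M) * (t \<bullet> x w))) \<le>
        4 / 3 * D ^ 3 * a ^ 3 + D ^ 4 / 4 * a ^ 4 + a\<^sup>2 * D\<^sup>2 * R w / M"
        using urn_conditional_characteristic_function[OF x0 \<open>M > 0\<close>, of t D a] D a
        unfolding \<tau>_def q_def R_def by blast
    qed
  qed simp_all
  also have "\<dots> = 4 / 3 * D ^ 3 * a ^ 3 + D ^ 4 / 4 * a ^ 4 + a\<^sup>2 * D\<^sup>2 * ?E n R / M"
    by simp
  also have "?E n R \<le> 3 * sqrt (n + 1)"
  proof -
    have "?E n R = ?E n (\<lambda>w. \<bar>x w $ 1\<bar>) + ?E n (\<lambda>w. \<bar>x w $ 2\<bar>) + ?E n (\<lambda>w. \<bar>x w $ 3\<bar>)"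
      unfolding R_def by simp
    moreover have "?E n (\<lambda>w. \<bar>x w $ 1\<bar>) \<le> sqrt (n + 1)"
      using second_moment_ascents[of n]
      by (intro measure_pmf.expectation_abs_le_of_second_moment) (auto simp: x_def vector_3 M_def)
    moreover have "?E n (\<lambda>w. \<bar>x w $ 2\<bar>) \<le> sqrt (n + 1)"
      using second_moment_descents[of n]
      by (intro measure_pmf.expectation_abs_le_of_second_moment) (auto simp: x_def vector_3 M_def)
    moreover have "?E n (\<lambda>w. \<bar>x w $ 3\<bar>) \<le> sqrt (n + 1)"
      using second_moment_plateaux[of n]
      by (intro measure_pmf.expectation_abs_le_of_second_moment) (auto simp: x_def vector_3 M_def)
    ultimately show ?thesis by linarith
  qed
  then have "a\<^sup>2 * D\<^sup>2 * ?E n R / M \<le> a\<^sup>2 * D\<^sup>2 * (3 * sqrt (n + 1)) / M"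
    using \<open>M > 0\<close> by (intro divide_right_mono mult_left_mono) auto
  also have "\<dots> \<le> a\<^sup>2 * D\<^sup>2 * (3 * sqrt (n + 1)) / (n + 1)"
    by (intro divide_left_mono) (auto simp: M_def)
  also have "\<dots> = 3 * D\<^sup>2 * a\<^sup>2 * (sqrt (n + 1) / (n + 1))" by simp
  also have "sqrt (n + 1) / (n + 1) = 1 / sqrt (n + 1)"
    by (rule sqrt_divide_self_eq[THEN trans]) (auto simp: inverse_eq_divide)
  finally show ?thesis by (simp add: add.commute)
qed

text \<open>The conditional expectation of the centered urn composition at time $k + 1$ is $2k/(2k+1)$ times
  the composition at time $k$, so multiplying by these weights gives a martingale; the
  normalisation makes the weight at time $N$ equal to $1/\sqrt{N}$. The weight at time $0$ vanishes.\<close>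

definition martingale_weight :: "nat \<Rightarrow> nat \<Rightarrow> real" where
  "martingale_weight N k = (\<Prod>j=k..<N. 2 * real j / (2 * real j + 1)) / sqrt N"

lemma martingale_weight_self: "martingale_weight N N = 1 / sqrt N"
  by (simp add: martingale_weight_def)

lemma martingale_weight_step:
  "k < N \<Longrightarrow> martingale_weight N k = martingale_weight N (Suc k) * (2 * real k / (2 * real k + 1))"
  by (simp add: martingale_weight_def prod.atLeast_Suc_lessThan mult_ac)

lemma martingale_weight_0: "0 < N \<Longrightarrow> martingale_weight N 0 = 0"
  by (simp add: martingale_weight_def prod.atLeast_Suc_lessThan)

lemma martingale_weight_nonneg: "0 \<le> martingale_weight N k"
  by (simp add: martingale_weight_def prod_nonneg)

section \<open>Asymptotics of the martingale weights\<close>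

text \<open>Downward induction from \<open>k = N\<close>, where the upper bound is attained.
  Multiplication by the squared factor \<open>c\<close> takes k+1 to at most k, and k + 3/4 to at
  least k - 1/4; the shift 1/4 is the one for which the terms linear in k cancel.\<close>

lemma martingale_weight_sq_bounds:
  assumes "k \<le> N" "0 < N"
  shows "(real k - 1 / 4) / (real N)\<^sup>2 \<le> (martingale_weight N k)\<^sup>2 \<and> (martingale_weight N k)\<^sup>2 \<le> real k / (real N)\<^sup>2"
  using assms(1)
proof (induction rule: inc_induct)
  case base
  have "(martingale_weight N N)\<^sup>2 = real N / (real N)\<^sup>2"
    using assms(2) by (simp add: martingale_weight_self power_divide power2_eq_square)
  then show ?case by (simp add: divide_right_mono)
next
  case (step k)
  define c where "c = (2 * real k / (2 * real k + 1))\<^sup>2"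
  have c: "c \<ge> 0" by (simp add: c_def)
  have w: "(martingale_weight N k)\<^sup>2 = (martingale_weight N (Suc k))\<^sup>2 * c"
    using step by (simp add: martingale_weight_step c_def flip: power_mult_distrib)
  have c_eq: "c = 4 * (real k)\<^sup>2 / (2 * real k + 1)\<^sup>2"
    by (simp add: c_def power_divide power_mult_distrib)
  have "(real k + 1) * (4 * (real k)\<^sup>2) \<le> real k * (2 * real k + 1)\<^sup>2"
    by (simp add: power2_eq_square algebra_simps)
  then have up: "(real k + 1) * c \<le> real k"
    unfolding c_eq by (simp add: divide_simps)
  have "(real k - 1 / 4) * (2 * real k + 1)\<^sup>2 \<le> (real k + 3 / 4) * (4 * (real k)\<^sup>2)"
    by (simp add: power2_eq_square algebra_simps)
  then have lo: "real k - 1 / 4 \<le> (real k + 3 / 4) * c"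
    unfolding c_eq by (simp add: divide_simps)
  have "(real k - 1 / 4) / (real N)\<^sup>2 \<le> (real k + 3 / 4) * c / (real N)\<^sup>2"
    using lo by (rule divide_right_mono) simp
  also have "\<dots> = (real (Suc k) - 1 / 4) / (real N)\<^sup>2 * c" by simp
  also have "\<dots> \<le> (martingale_weight N (Suc k))\<^sup>2 * c"
    using step c by (intro mult_right_mono) auto
  finally have 1: "(real k - 1 / 4) / (real N)\<^sup>2 \<le> (martingale_weight N k)\<^sup>2" by (simp add: w)
  have "(martingale_weight N (Suc k))\<^sup>2 * c \<le> real (Suc k) / (real N)\<^sup>2 * c"
    using step c by (intro mult_right_mono) auto
  also have "\<dots> = (real k + 1) * c / (real N)\<^sup>2" by simp
  also have "\<dots> \<le> real k / (real N)\<^sup>2"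
    using up by (rule divide_right_mono) simp
  finally show ?case using 1 by (simp add: w)
qed

text \<open>The squared weights are k/N^2 up to 1/(4N^2), so the sum is an arithmetic series up to
  O(1/N). This limit turns the exponent q/2 into q/4.\<close>

lemma sum_martingale_weight_sq_tendsto:
  "(\<lambda>N. \<Sum>k=1..N. (martingale_weight N k)\<^sup>2) \<longlonglongrightarrow> 1 / 2"
proof (rule tendsto_sandwich)
  have sum_real: "(\<Sum>k=Suc 0..N. real k) = real N * (real N + 1) / 2" for N
    by (induction N) (auto simp: field_simps)
  show "\<forall>\<^sub>F N in sequentially. (1 / 2 + 1 / (4 * real N)) \<le> (\<Sum>k=1..N. (martingale_weight N k)\<^sup>2)"
    using eventually_gt_at_top[of 0]
  proof eventually_elim
    case (elim N)
    have "(\<Sum>k=1..N. (martingale_weight N k)\<^sup>2) \<ge> (\<Sum>k=1..N. (real k - 1 / 4) / (real N)\<^sup>2)"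
      using martingale_weight_sq_bounds elim by (intro sum_mono) auto
    also have "(\<Sum>k=1..N. (real k - 1 / 4) / (real N)\<^sup>2) = 1 / 2 + 1 / (4 * real N)"
      using elim by (simp add: sum_subtractf sum_real flip: sum_divide_distrib) (simp add: field_simps power2_eq_square)
    finally show ?case .
  qed
  show "\<forall>\<^sub>F N in sequentially. (\<Sum>k=1..N. (martingale_weight N k)\<^sup>2) \<le> 1 / 2 + 1 / (2 * real N)"
    using eventually_gt_at_top[of 0]
  proof eventually_elim
    case (elim N)
    have "(\<Sum>k=1..N. (martingale_weight N k)\<^sup>2) \<le> (\<Sum>k=1..N. real k / (real N)\<^sup>2)"
      using martingale_weight_sq_bounds elim by (intro sum_mono) auto
    also have "(\<Sum>k=1..N. real k / (real N)\<^sup>2) = 1 / 2 + 1 / (2 * real N)"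
      using elim by (simp add: sum_real flip: sum_divide_distrib) (simp add: field_simps power2_eq_square)
    finally show ?case .
  qed
  show "(\<lambda>N. 1 / 2 + 1 / (4 * real N)) \<longlonglongrightarrow> 1 / 2" "(\<lambda>N. 1 / 2 + 1 / (2 * real N)) \<longlonglongrightarrow> 1 / 2"
    by real_asymp+
qed

text \<open>Each of the N steps multiplies the characteristic function by a Gaussian factor, up to
  an error of order N^(-3/2). The factors are at most 1, so earlier errors are not amplified and the
  total is of order N^(-1/2).\<close>

lemma urn_characteristic_function_tendsto:
  fixes t :: "real ^ 3"
  defines "\<tau> \<equiv> (t $ 1 + t $ 2 + t $ 3) / 3"
  defines "q \<equiv> ((\<tau> - t $ 1)\<^sup>2 + (\<tau> - t $ 2)\<^sup>2 + (\<tau> - t $ 3)\<^sup>2) / 3"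
  shows "(\<lambda>N. measure_pmf.expectation (random_stirling N) (\<lambda>w. cis (1 / sqrt N * urn_deviation t N w)))
    \<longlonglongrightarrow> complex_of_real (exp (- (q / 4)))"
proof -
  define D where "D = \<bar>\<tau> - t $ 1\<bar> + \<bar>\<tau> - t $ 2\<bar> + \<bar>\<tau> - t $ 3\<bar>"
  have "\<forall>j. \<bar>\<tau> - t $ j\<bar> \<le> D" unfolding forall_3 D_def by auto
  then have D: "\<bar>\<tau> - t $ j\<bar> \<le> D" for j by blast
  have "D \<ge> 0" by (simp add: D_def)
  have "q \<ge> 0" by (simp add: q_def)
  define K where "K = 4 / 3 * D ^ 3 + D ^ 4 / 4 + 3 * D\<^sup>2"
  define h where "h N k = measure_pmf.expectation (random_stirling k) (\<lambda>w. cis (martingale_weight N k * urn_deviation t k w))" for N k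
  \<comment> \<open>The accumulated squared weights: exp (- q V / 2) is the product of the Gaussian
    factors of the first \<open>k\<close> steps.\<close>
  define V where "V N k = (\<Sum>j=1..k. (martingale_weight N j)\<^sup>2)" for N k
  have step: "norm (h N (Suc k) - complex_of_real (exp (- ((martingale_weight N (Suc k))\<^sup>2 * q / 2))) * h N k) \<le> K / (N * sqrt N)"
    if "k < N" for N k
  proof -
    define a where "a = martingale_weight N (Suc k)"
    have N: "real N > 0" using that by simp
    have "a \<ge> 0" by (simp add: a_def martingale_weight_nonneg)
    have a2: "a\<^sup>2 \<le> (real k + 1) / (real N)\<^sup>2"
      using martingale_weight_sq_bounds[of "Suc k" N] that by (simp add: a_def add.commute)
    also have "\<dots> \<le> real N / (real N)\<^sup>2" using that by (intro divide_right_mono) auto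
    finally have a2N: "a\<^sup>2 \<le> 1 / N" using N by (simp add: power2_eq_square)
    have "sqrt (a\<^sup>2) \<le> sqrt (1 / N)" using a2N by (rule real_sqrt_le_mono)
    then have aN: "a \<le> 1 / sqrt N" using \<open>a \<ge> 0\<close> by (simp add: real_sqrt_divide)
    have a3: "a ^ 3 \<le> 1 / (N * sqrt N)"
    proof -
      have "a ^ 3 = a\<^sup>2 * a" by (simp add: power2_eq_square power3_eq_cube)
      also have "\<dots> \<le> 1 / N * (1 / sqrt N)" using a2N aN \<open>a \<ge> 0\<close> by (intro mult_mono) auto
      finally show ?thesis by simp
    qed
    have "a \<le> 1"
    proof -
      have "1 / sqrt N \<le> 1" using that by simp
      then show ?thesis using aN by linarith
    qed
    then have a4: "a ^ 4 \<le> 1 / (N * sqrt N)"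
      using power_decreasing[of 3 4 a] \<open>a \<ge> 0\<close> a3 by linarith
    \<comment> \<open>The sharper bound (k+1)/N^2 on \<open>a\<^sup>2\<close> enters here: it
      offsets the large 1/sqrt (k+1) of early steps and makes the estimate uniform in
      \<open>k\<close>.\<close>
    have a2k: "a\<^sup>2 / sqrt (k + 1) \<le> 1 / (N * sqrt N)"
    proof -
      have "a\<^sup>2 / sqrt (k + 1) \<le> (real k + 1) / (real N)\<^sup>2 / sqrt (k + 1)"
        using a2 by (rule divide_right_mono) simp
      also have "\<dots> = (real k + 1) / sqrt (real k + 1) / (real N)\<^sup>2" by simp
      also have "(real k + 1) / sqrt (real k + 1) = sqrt (real k + 1)"
        by (simp add: real_div_sqrt)
      also have "sqrt (real k + 1) / (real N)\<^sup>2 \<le> sqrt N / (real N)\<^sup>2"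
        using that by (intro divide_right_mono) auto
      also have "\<dots> = 1 / (N * sqrt N)"
        using N by (simp add: power2_eq_square field_simps)
      finally show ?thesis .
    qed
    have "norm (h N (Suc k) - complex_of_real (exp (- (a\<^sup>2 * q / 2))) * h N k) \<le>
        4 / 3 * D ^ 3 * a ^ 3 + D ^ 4 / 4 * a ^ 4 + 3 * D\<^sup>2 * a\<^sup>2 / sqrt (k + 1)"
      using urn_characteristic_function_step[of t D a k] D \<open>a \<ge> 0\<close> martingale_weight_step[OF that]
      by (simp add: \<tau>_def q_def h_def a_def add.commute)
    also have "\<dots> = 4 / 3 * D ^ 3 * a ^ 3 + D ^ 4 / 4 * a ^ 4 + 3 * D\<^sup>2 * (a\<^sup>2 / sqrt (k + 1))" by simp
    also have "\<dots> \<le> 4 / 3 * D ^ 3 * (1 / (N * sqrt N)) + D ^ 4 / 4 * (1 / (N * sqrt N)) + 3 * D\<^sup>2 * (1 / (N * sqrt N))"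
      using a3 a4 a2k \<open>D \<ge> 0\<close> by (intro add_mono mult_left_mono) auto
    also have "\<dots> = K * (1 / (N * sqrt N))" unfolding K_def distrib_right ..
    finally show ?thesis by (simp add: a_def)
  qed
  have main: "norm (h N k - complex_of_real (exp (- (q / 2 * V N k)))) \<le> k * (K / (N * sqrt N))" if "k \<le> N" "0 < N" for N k
    using that(1)
  proof (induction k)
    \<comment> \<open>The weight at time 0 vanishes, so both quantities equal 1 and the induction
      starts without error.\<close>
    case 0
    then show ?case using that by (simp add: h_def V_def martingale_weight_0)
  next
    case (Suc k)
    let ?r = "exp (- ((martingale_weight N (Suc k))\<^sup>2 * q / 2))"
    have "V N (Suc k) = V N k + (martingale_weight N (Suc k))\<^sup>2" by (simp add: V_def)
    then have "exp (- (q / 2 * V N (Suc k))) = ?r * exp (- (q / 2 * V N k))"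
      by (simp add: exp_add[symmetric] algebra_simps)
    then have "h N (Suc k) - complex_of_real (exp (- (q / 2 * V N (Suc k)))) =
        (h N (Suc k) - complex_of_real ?r * h N k) + complex_of_real ?r * (h N k - complex_of_real (exp (- (q / 2 * V N k))))"
      by (simp add: algebra_simps flip: of_real_mult)
    moreover have "norm (complex_of_real ?r * (h N k - complex_of_real (exp (- (q / 2 * V N k))))) \<le> 1 * (k * (K / (N * sqrt N)))"
      unfolding norm_mult using Suc \<open>q \<ge> 0\<close> by (intro mult_mono) auto
    ultimately have "norm (h N (Suc k) - complex_of_real (exp (- (q / 2 * V N (Suc k))))) \<le> K / (N * sqrt N) + k * (K / (N * sqrt N))"
      using norm_triangle_mono[OF step[of k N]] Suc.prems by (metis Suc_le_lessD mult_1)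
    then show ?case by (simp only: of_nat_Suc distrib_right mult_1 add.commute)
  qed
  have bound: "norm (h N N - complex_of_real (exp (- (q / 2 * V N N)))) \<le> K * (1 / sqrt N)" if "0 < N" for N
    using main[of N N] that by simp
  have "(\<lambda>N. h N N - complex_of_real (exp (- (q / 2 * V N N)))) \<longlonglongrightarrow> 0"
  proof (rule Lim_null_comparison)
    show "\<forall>\<^sub>F N in sequentially. norm (h N N - complex_of_real (exp (- (q / 2 * V N N)))) \<le> K * (1 / sqrt N)"
      using eventually_gt_at_top[of 0] by eventually_elim (rule bound)
    have "(\<lambda>N. 1 / sqrt (real N)) \<longlonglongrightarrow> 0" by real_asymp
    then show "(\<lambda>N. K * (1 / sqrt (real N))) \<longlonglongrightarrow> 0" by (rule tendsto_mult_right_zero)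
  qed
  moreover have "(\<lambda>N. complex_of_real (exp (- (q / 2 * V N N)))) \<longlonglongrightarrow> complex_of_real (exp (- (q / 2 * (1 / 2))))"
    unfolding V_def by (intro tendsto_of_real tendsto_exp tendsto_minus tendsto_mult_left sum_martingale_weight_sq_tendsto)
  ultimately have "(\<lambda>N. h N N) \<longlonglongrightarrow> complex_of_real (exp (- (q / 2 * (1 / 2))))"
    by (rule Lim_transform[rotated])
  then show ?thesis by (simp add: h_def martingale_weight_self)
qed

section \<open>Joint limit law of ascents, descents and plateaux\<close>

theorem theorem2p3:
  "\<exists>N :: (real ^ 3) measure.
     multivariate_normal 0
       ((1 / 18) *\<^sub>R vector [vector [ 2, -1, -1],
                          vector [-1,  2, -1],
                          vector [-1, -1,  2]]) N \<and>
     weakly_converges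
       (\<lambda>n. distr (random_stirling n) borel
          (\<lambda>w. (1 / sqrt (real n)) *\<^sub>R
             vector [real (ascents w)  - 2 * real n / 3,
                     real (descents w) - 2 * real n / 3,
                     real (plateaux w) - 2 * real n / 3]))
       N"
proof -
  \<comment> \<open>Orthogonal vectors spanning the plane $x + y + z = 0$, scaled so that $e e^T + f f^T = \Sigma$.\<close>
  define e f :: "real ^ 3" where "e = vector [1 / sqrt 12, - 1 / sqrt 12, 0]" and "f = vector [1 / 6, 1 / 6, - 1 / 3]"
  define N where "N = two_factor_gaussian e f"
  define W :: "nat \<Rightarrow> nat list \<Rightarrow> real ^ 3" where
    "W n w = (1 / sqrt (real n)) *\<^sub>R
             vector [real (ascents w)  - 2 * real n / 3,
                     real (descents w) - 2 * real n / 3,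
                     real (plateaux w) - 2 * real n / 3]" for n w
  have "(\<chi> i j. e $ i * e $ j + f $ i * f $ j) =
     ((1 / 18) *\<^sub>R vector [vector [ 2, -1, -1], vector [-1,  2, -1], vector [-1, -1,  2]] :: real ^ 3 ^ 3)"
    by (simp add: vec_eq_iff forall_3 vector_3 e_def f_def field_simps)
  then have normal: "multivariate_normal 0
       ((1 / 18) *\<^sub>R vector [vector [ 2, -1, -1], vector [-1,  2, -1], vector [-1, -1,  2]]) N"
    using multivariate_normal_two_factor_gaussian[of e f] by (simp add: N_def)
  have sq: "(norm x)\<^sup>2 = (x $ 1)\<^sup>2 + (x $ 2)\<^sup>2 + (x $ 3)\<^sup>2" for x :: "real ^ 3"
    by (simp add: power2_norm_eq_inner inner_vec_def sum_3) (simp add: power2_eq_square)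
  have N_prob: "prob_space N" and N_sets: "sets N = sets borel"
    by (simp_all add: N_def prob_space_two_factor_gaussian sets_two_factor_gaussian)
  have N_sq: "integrable N (\<lambda>x. (x $ j)\<^sup>2)" "(\<integral>x. (x $ j)\<^sup>2 \<partial>N) = (e $ j)\<^sup>2 + (f $ j)\<^sup>2" for j
    using integrable_inner_sq_two_factor_gaussian[of e f "axis j 1"]
      integral_inner_sq_two_factor_gaussian[of e f "axis j 1"]
    by (simp_all add: inner_axis' N_def)
  \<comment> \<open>The trace of the limit covariance is only 1/3; the bound 14 is shared with the
    finite-n laws, where it dominates (6 (n+1) + 2/3)/n for n \<ge> 1.\<close>
  have N_int: "integrable N (\<lambda>x. (norm x)\<^sup>2)" and N_mom: "(\<integral>x. (norm x)\<^sup>2 \<partial>N) \<le> 14"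
    unfolding sq by (simp_all add: N_sq e_def f_def vector_3 power_divide)
  let ?M = "\<lambda>n. distr (random_stirling n) borel (W n)"
  have M_prob: "prob_space (?M n)" and M_sets: "sets (?M n) = sets borel" for n
    by (auto intro!: measure_pmf.prob_space_distr)
  have M_int: "integrable (?M n) (\<lambda>x. (norm x)\<^sup>2)" for n
    by (subst integrable_distr_eq) auto
  have M_mom: "(\<integral>x. (norm x)\<^sup>2 \<partial>?M n) \<le> 14" for n
  proof (cases "n = 0")
    \<comment> \<open>Here \<open>1 / sqrt 0 = 0\<close>, so the normalized vector is zero.\<close>
    case True
    then show ?thesis by (subst integral_distr) (auto simp: W_def)
  next
    case False
    then have n: "real n \<ge> 1" by simp
    let ?E = "measure_pmf.expectation (random_stirling n)"
    let ?c = "(2 * real n + 1) / 3"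
    \<comment> \<open>(u + v)^2 \<le> 2 u^2 + 2 v^2 with v = 1/3, the distance between the centres
      (2n+1)/3 and 2n/3.\<close>
    have ineq: "(x - 2 * real n / 3)\<^sup>2 \<le> 2 * (x - ?c)\<^sup>2 + 2 / 9" for x
    proof -
      have "2 * (x - ?c)\<^sup>2 + 2 / 9 - (x - 2 * real n / 3)\<^sup>2 = (x - ?c - 1 / 3)\<^sup>2"
        by (simp add: power2_eq_square field_simps)
      then show ?thesis using zero_le_power2[of "x - ?c - 1 / 3"] by linarith
    qed
    have "(norm (W n w))\<^sup>2 \<le> (2 * (ascents w - ?c)\<^sup>2 + 2 * (descents w - ?c)\<^sup>2 + 2 * (plateaux w - ?c)\<^sup>2 + 2 / 3) / n" for w
    proof -
      have "(norm (W n w))\<^sup>2 = ((ascents w - 2 * real n / 3)\<^sup>2 + (descents w - 2 * real n / 3)\<^sup>2 + (plateaux w - 2 * real n / 3)\<^sup>2) / n"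
        unfolding sq by (simp add: W_def vector_3 power_divide add_divide_distrib)
      also have "\<dots> \<le> (2 * (ascents w - ?c)\<^sup>2 + 2 * (descents w - ?c)\<^sup>2 + 2 * (plateaux w - ?c)\<^sup>2 + 2 / 3) / n"
        using ineq[of "ascents w"] ineq[of "descents w"] ineq[of "plateaux w"]
        by (intro divide_right_mono) auto
      finally show ?thesis .
    qed
    then have "?E (\<lambda>w. (norm (W n w))\<^sup>2) \<le> ?E (\<lambda>w. (2 * (ascents w - ?c)\<^sup>2 + 2 * (descents w - ?c)\<^sup>2 + 2 * (plateaux w - ?c)\<^sup>2 + 2 / 3) / n)"
      by (intro integral_mono) auto
    also have "\<dots> = (2 * ?E (\<lambda>w. (ascents w - ?c)\<^sup>2) + 2 * ?E (\<lambda>w. (descents w - ?c)\<^sup>2) + 2 * ?E (\<lambda>w. (plateaux w - ?c)\<^sup>2) + 2 / 3) / n"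
      by simp
    also have "\<dots> \<le> (6 * (real n + 1) + 2 / 3) / n"
      using second_moment_ascents[of n] second_moment_descents[of n] second_moment_plateaux[of n]
      by (intro divide_right_mono) auto
    also have "\<dots> \<le> 14" using n by (simp add: field_simps)
    finally show ?thesis by (subst integral_distr) auto
  qed
  have "weakly_converges ?M N"
  proof (rule weakly_converges_if_characteristic_functions_converge[OF M_prob M_sets N_prob N_sets])
    fix \<delta> :: real assume "\<delta> > 0"
    \<comment> \<open>This radius makes the Chebyshev bound 14/L^2 equal to
      \<open>\<delta>\<close>.\<close>
    define L where "L = sqrt (14 / \<delta>)"
    have L: "L > 0" "14 / L\<^sup>2 = \<delta>" using \<open>\<delta> > 0\<close> by (simp_all add: L_def)
    show "\<exists>L>0. (\<forall>n. measure (?M n) {x. norm x > L} \<le> \<delta>) \<and> measure N {x. norm x > L} \<le> \<delta>"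
      using measure_norm_gt_le_second_moment[OF M_prob M_sets M_int M_mom L(1)]
        measure_norm_gt_le_second_moment[OF N_prob N_sets N_int N_mom L(1)] L by auto
  next
    fix t :: "real ^ 3"
    define \<tau> where "\<tau> = (t $ 1 + t $ 2 + t $ 3) / 3"
    define q where "q = ((\<tau> - t $ 1)\<^sup>2 + (\<tau> - t $ 2)\<^sup>2 + (\<tau> - t $ 3)\<^sup>2) / 3"
    let ?h = "\<lambda>n. measure_pmf.expectation (random_stirling n) (\<lambda>w. cis (1 / sqrt n * urn_deviation t n w))"
    \<comment> \<open>Changing the centre by 1/3 in each coordinate contributes
      \<open>\<tau>\<close>, which vanishes in the limit after division by sqrt n; for
      \<open>n = 0\<close> both sides are zero.\<close>
    have "t \<bullet> W n w = \<tau> / sqrt n + 1 / sqrt n * urn_deviation t n w" for n w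
      by (cases "n = 0") (simp_all add: W_def inner_vec_def sum_3 vector_3 urn_deviation_def \<tau>_def field_simps)
    then have "(\<integral>x. cis (t \<bullet> x) \<partial>?M n) = cis (\<tau> / sqrt n) * ?h n" for n
      by (subst integral_distr) (auto simp flip: cis_mult)
    moreover have "(\<lambda>n. cis (\<tau> / sqrt n) * ?h n) \<longlonglongrightarrow> cis 0 * complex_of_real (exp (- (q / 4)))"
    proof (rule tendsto_mult)
      have "(\<lambda>n. \<tau> / sqrt (real n)) \<longlonglongrightarrow> 0" by real_asymp
      then show "(\<lambda>n. cis (\<tau> / sqrt (real n))) \<longlonglongrightarrow> cis 0"
        by (rule tendsto_cis)
      show "?h \<longlonglongrightarrow> complex_of_real (exp (- (q / 4)))"
        unfolding q_def \<tau>_def by (rule urn_characteristic_function_tendsto)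
    qed
    \<comment> \<open>Both sides are half the quadratic form of the limit covariance at
      \<open>t\<close>: it equals q/2, with \<open>q\<close> the variance of t_j for a uniform
      colour j.\<close>
    moreover have "q / 4 = ((t \<bullet> e)\<^sup>2 + (t \<bullet> f)\<^sup>2) / 2"
    proof -
      have te: "t \<bullet> e = (t $ 1 - t $ 2) / sqrt 12" and tf: "t \<bullet> f = (t $ 1 + t $ 2 - 2 * t $ 3) / 6"
        by (simp_all add: e_def f_def inner_vec_def sum_3 vector_3 field_simps)
      have "((t \<bullet> e)\<^sup>2 + (t \<bullet> f)\<^sup>2) / 2 =
          ((t $ 1 - t $ 2)\<^sup>2 / 12 + (t $ 1 + t $ 2 - 2 * t $ 3)\<^sup>2 / 36) / 2"
        unfolding te tf power_divide by simp
      also have "\<dots> = q / 4"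
        unfolding q_def \<tau>_def by (simp add: power2_eq_square field_simps)
      finally show ?thesis by simp
    qed
    then have "(\<integral>x. cis (t \<bullet> x) \<partial>N) = complex_of_real (exp (- (q / 4)))"
      unfolding N_def characteristic_function_two_factor_gaussian minus_divide_left[symmetric] by (simp only:)
    ultimately show "(\<lambda>n. \<integral>x. cis (t \<bullet> x) \<partial>?M n) \<longlonglongrightarrow> (\<integral>x. cis (t \<bullet> x) \<partial>N)"
      by simp
  qed
  then show ?thesis using normal unfolding W_def by blast
qed

end
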